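(* In the setting where the set of alternatives equals the set of agents $C$, $|C|=n$, and for all $k,\ell\in\{1,\dots,n\}$, mechanisms running in polynomial time can compute: (a) an estimate $B_1$ such that $\mathrm{OPT}_\ell\le B_1\le 2\ell\cdot\mathrm{OPT}_\ell$, using $O(k)$ queries per agent and $O(k^2)$ queries in total; (b) (by a randomized mechanism) an estimate $B_n$ such that $\mathrm{OPT}_\ell\le B_n\le 8(\ln k+2)\cdot\frac{n}{\ell}\cdot\mathrm{OPT}_\ell$ holds with probability at least $1/2$, using $O(k)$ queries per agent.
   Context: Setting. $C$ is a finite set of $n$ agents, and the set of alternatives is also $C$. There is an underlying (unknown) pseudometric $d$ on $C$ (symmetric, nonnegative, $d(i,i)=0$, triangle inequality; distinct points may be at distance $0$). The preference profile $\sigma=(\succeq_i)_{i\in C}$ consists of total orders $\succeq_i$ on $C$ that are consistent with $d$: $a\succeq_i b$ implies $d(i,a)\le d(i,b)$; each agent ranks itself first. For $\emptyset\ne S\subseteq C$, $d(i,S)=\min_{a\in S}d(i,a)$ and $d(C,S)=(d(i,S))_{i\in C}$. For a vector $v\in\mathbb R_{\ge0}^n$, $\mathrm{Top}_\ell(v)$ is the sum of its $\ell$ largest entries. The $\ell$-centrum problem asks for $S\subseteq C$ with $1\le|S|\le k$ minimizing $\mathrm{Top}_\ell(d(C,S))$; its optimal value is $\mathrm{OPT}_\ell$. Mechanisms. A mechanism receives $C,\sigma,k,\ell$ (but not $d$), may use randomness where stated, and may adaptively make value queries: a value query to agent $i$ about alternative $a$ returns $d(i,a)$. Its output depends on $d$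 only through the answers. The number of queries per agent is the maximum number of queries made to any single agent; the total number of queries is the sum over all agents. Implied constants are absolute. *)

theory Defs
  imports "HOL-Probability.Probability" "HOL-Computational_Algebra.Polynomial"
begin

section \<open>The l-centrum problem\<close>

definition pseudometric_on :: "'a set \<Rightarrow> ('a \<Rightarrow> 'a \<Rightarrow> real) \<Rightarrow> bool" where
  "pseudometric_on C d \<longleftrightarrow>
     (\<forall>i\<in>C. d i i = 0) \<and>
     (\<forall>i\<in>C. \<forall>j\<in>C. 0 \<le> d i j \<and> d i j = d j i) \<and>
     (\<forall>i\<in>C. \<forall>j\<in>C. \<forall>h\<in>C. d i h \<le> d i j + d j h)"

text \<open>A pair \<open>(a, b) \<in> \<sigma> i\<close> means that agent \<open>i\<close> ranks \<open>a\<close> at least as high as \<open>b\<close>.\<close>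

definition consistent_profile ::
    "'a set \<Rightarrow> ('a \<Rightarrow> 'a rel) \<Rightarrow> ('a \<Rightarrow> 'a \<Rightarrow> real) \<Rightarrow> bool" where
  "consistent_profile C \<sigma> d \<longleftrightarrow>
     (\<forall>i\<in>C. linear_order_on C (\<sigma> i) \<and>
             (\<forall>a\<in>C. (i, a) \<in> \<sigma> i) \<and>
             (\<forall>a b. (a, b) \<in> \<sigma> i \<longrightarrow> d i a \<le> d i b))"

definition set_dist :: "('a \<Rightarrow> 'a \<Rightarrow> real) \<Rightarrow> 'a \<Rightarrow> 'a set \<Rightarrow> real" where
  "set_dist d i S = Min (d i ` S)"

text \<open>Sum of the \<open>l\<close> largest entries, counted with multiplicity, of the vector \<open>(v i)\<close>
  indexed by \<open>i \<in> C\<close>.\<close>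

definition Top :: "nat \<Rightarrow> 'a set \<Rightarrow> ('a \<Rightarrow> real) \<Rightarrow> real" where
  "Top l C v =
     sum_list (take l (rev (sorted_list_of_multiset (image_mset v (mset_set C)))))"

definition OPT :: "'a set \<Rightarrow> ('a \<Rightarrow> 'a \<Rightarrow> real) \<Rightarrow> nat \<Rightarrow> nat \<Rightarrow> real" where
  "OPT C d k l =
     Min ((\<lambda>S. Top l C (\<lambda>i. set_dist d i S)) ` {S. S \<subseteq> C \<and> 1 \<le> card S \<and> card S \<le> k})"

section \<open>Mechanisms\<close>

text \<open>
  Mechanisms are programs of a random access machine that works on arrays of natural numbers and
  arrays of reals; a scalar variable is entry 0 of an array.  Only additive arithmetic is
  available and no real constants other than natural numbers, so that unit cost time is
  polynomially related to bit cost.  On naturals, \<open>NSub\<close> is truncated subtraction.  The machine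
  can compare two alternatives in the ranking of an agent (\<open>Prefers\<close>); the distances are
  accessible only through the command \<open>Query\<close>.

  The command \<open>Toss x e p q\<close> stores in \<open>x[e]\<close> the outcome (1 or 0) of a coin that shows 1 with
  probability \<open>p / q\<close>, clipped to the unit interval.
\<close>

type_synonym vname = string

datatype nexp =
    NConst nat
  | NVar vname nexp
  | NAdd nexp nexp
  | NSub nexp nexp

datatype rexp =
    RVar vname nexp
  | RNat nexp
  | RAdd rexp rexp
  | RSub rexp rexp

datatype bexp =
    NLess nexp nexp
  | RLess rexp rexp
  | Prefers nexp nexp nexp
  | Neg bexp
  | Conj bexp bexp

datatype com =
    SKIP
  | NAssign vname nexp nexp
  | RAssign vname nexp rexp
  | Query vname nexp nexp nexp
  | Toss vname nexp rexp rexp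
  | Seq com com
  | Cond bexp com com
  | While bexp com

primrec coin_free :: "com \<Rightarrow> bool" where
  "coin_free SKIP = True"
| "coin_free (NAssign x e f) = True"
| "coin_free (RAssign x e f) = True"
| "coin_free (Query x e i a) = True"
| "coin_free (Toss x e p q) = False"
| "coin_free (Seq c1 c2) = (coin_free c1 \<and> coin_free c2)"
| "coin_free (Cond b c1 c2) = (coin_free c1 \<and> coin_free c2)"
| "coin_free (While b c) = coin_free c"

text \<open>The component \<open>queries\<close> is a log of all value queries (agent, alternative) made so far; it
  is not accessible to the program.\<close>

record state =
  nmem :: "vname \<Rightarrow> nat \<Rightarrow> nat"
  rmem :: "vname \<Rightarrow> nat \<Rightarrow> real"
  queries :: "(nat \<times> nat) list"

primrec nval :: "nexp \<Rightarrow> state \<Rightarrow> nat" where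
  "nval (NConst m) s = m"
| "nval (NVar x e) s = nmem s x (nval e s)"
| "nval (NAdd e f) s = nval e s + nval f s"
| "nval (NSub e f) s = nval e s - nval f s"

primrec rval :: "rexp \<Rightarrow> state \<Rightarrow> real" where
  "rval (RVar x e) s = rmem s x (nval e s)"
| "rval (RNat e) s = real (nval e s)"
| "rval (RAdd e f) s = rval e s + rval f s"
| "rval (RSub e f) s = rval e s - rval f s"

text \<open>The agents (and alternatives) are \<open>{..<n}\<close>.  The values of \<open>\<sigma>\<close> and \<open>d\<close> outside
  \<open>{..<n}\<close> are hidden from the program.\<close>

primrec bval :: "nat \<Rightarrow> (nat \<Rightarrow> nat rel) \<Rightarrow> bexp \<Rightarrow> state \<Rightarrow> bool" where
  "bval n \<sigma> (NLess e f) s = (nval e s < nval f s)"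
| "bval n \<sigma> (RLess e f) s = (rval e s < rval f s)"
| "bval n \<sigma> (Prefers i a b) s =
     (nval i s < n \<and> nval a s < n \<and> nval b s < n \<and> (nval a s, nval b s) \<in> \<sigma> (nval i s))"
| "bval n \<sigma> (Neg b) s = (\<not> bval n \<sigma> b s)"
| "bval n \<sigma> (Conj b b') s = (bval n \<sigma> b s \<and> bval n \<sigma> b' s)"

definition answer :: "nat \<Rightarrow> (nat \<Rightarrow> nat \<Rightarrow> real) \<Rightarrow> nat \<Rightarrow> nat \<Rightarrow> real" where
  "answer n d i a = (if i < n \<and> a < n then d i a else 0)"

definition set_nmem :: "vname \<Rightarrow> nat \<Rightarrow> nat \<Rightarrow> state \<Rightarrow> state" where
  "set_nmem x j v s = s\<lparr>nmem := (nmem s)(x := (nmem s x)(j := v))\<rparr>"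

definition set_rmem :: "vname \<Rightarrow> nat \<Rightarrow> real \<Rightarrow> state \<Rightarrow> state" where
  "set_rmem x j v s = s\<lparr>rmem := (rmem s)(x := (rmem s x)(j := v))\<rparr>"

primrec step ::
    "nat \<Rightarrow> (nat \<Rightarrow> nat rel) \<Rightarrow> (nat \<Rightarrow> nat \<Rightarrow> real) \<Rightarrow> com \<Rightarrow> state \<Rightarrow> (com \<times> state) pmf" where
  "step n \<sigma> d SKIP s = return_pmf (SKIP, s)"
| "step n \<sigma> d (NAssign x e f) s = return_pmf (SKIP, set_nmem x (nval e s) (nval f s) s)"
| "step n \<sigma> d (RAssign x e f) s = return_pmf (SKIP, set_rmem x (nval e s) (rval f s) s)"
| "step n \<sigma> d (Query x e i a) s =
     return_pmf (SKIP,
       (set_rmem x (nval e s) (answer n d (nval i s) (nval a s)) s)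
         \<lparr>queries := (nval i s, nval a s) # queries s\<rparr>)"
| "step n \<sigma> d (Toss x e p q) s =
     map_pmf (\<lambda>r. (SKIP, set_nmem x (nval e s) (of_bool r) s))
       (bernoulli_pmf (rval p s / rval q s))"
| "step n \<sigma> d (Seq c1 c2) s =
     (if c1 = SKIP then return_pmf (c2, s)
      else map_pmf (\<lambda>(c, s'). (Seq c c2, s')) (step n \<sigma> d c1 s))"
| "step n \<sigma> d (Cond b c1 c2) s = return_pmf (if bval n \<sigma> b s then c1 else c2, s)"
| "step n \<sigma> d (While b c) s =
     return_pmf (if bval n \<sigma> b s then Seq c (While b c) else SKIP, s)"

primrec steps ::
    "nat \<Rightarrow> (nat \<Rightarrow> nat rel) \<Rightarrow> (nat \<Rightarrow> nat \<Rightarrow> real) \<Rightarrow> nat \<Rightarrow> com \<times> state \<Rightarrow> (com \<times> state) pmf" where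
  "steps n \<sigma> d 0 cs = return_pmf cs"
| "steps n \<sigma> d (Suc t) cs = bind_pmf (step n \<sigma> d (fst cs) (snd cs)) (steps n \<sigma> d t)"

definition init_state :: "nat \<Rightarrow> nat \<Rightarrow> nat \<Rightarrow> state" where
  "init_state n k l =
     \<lparr>nmem = (\<lambda>x j. if j \<noteq> 0 then 0
                     else if x = ''n'' then n
                     else if x = ''k'' then k
                     else if x = ''l'' then l
                     else 0),
      rmem = (\<lambda>x j. 0),
      queries = []\<rparr>"

text \<open>Distribution of the configuration reached after \<open>t\<close> steps.\<close>

definition run ::
    "com \<Rightarrow> nat \<Rightarrow> nat \<Rightarrow> nat \<Rightarrow> (nat \<Rightarrow> nat rel) \<Rightarrow> (nat \<Rightarrow> nat \<Rightarrow> real) \<Rightarrow> nat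
       \<Rightarrow> (com \<times> state) pmf" where
  "run c n k l \<sigma> d t = steps n \<sigma> d t (c, init_state n k l)"

text \<open>A halted configuration is a fixed point of \<open>step\<close>, so after halting the result and the
  query log no longer change.\<close>

definition halted :: "com \<times> state \<Rightarrow> bool" where
  "halted cs \<longleftrightarrow> fst cs = SKIP"

definition estimate :: "com \<times> state \<Rightarrow> real" where
  "estimate cs = rmem (snd cs) ''out'' 0"

definition agent_queries :: "com \<times> state \<Rightarrow> nat \<Rightarrow> nat" where
  "agent_queries cs i = length (filter (\<lambda>q. fst q = i) (queries (snd cs)))"

definition total_queries :: "nat \<Rightarrow> com \<times> state \<Rightarrow> nat" where
  "total_queries n cs = (\<Sum>i<n. agent_queries cs i)"

end

theory Submission
  imports Defs
begin

text \<open>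
  For (a), the estimate is \<open>l\<close> times the radius of the centers found by farthest-first traversal.
  The agent farthest from the current centers is found with one query per center: each agent
  belongs to its favorite center, and by symmetry of the distance each center knows from its own
  ranking which of its agents is farthest.

  For (b), the estimate is the sum of the distances to centers sampled as in k-means++, with
  probabilities proportional to the distances.  In expectation this sum is at most
  \<open>4 (ln k + 2)\<close> times the optimum for \<open>l = n\<close>, which is at most \<open>n / l\<close> times the optimum for
  \<open>l\<close>; Markov's inequality costs another factor 2.
\<close>

section \<open>The l-centrum objective and sampling by distance\<close>

text \<open>For (a), \<open>Top l\<close> lies between the largest entry and \<open>l\<close> times
  it. The final centers together with the agent farthest from them are \<open>k + 1\<close> points
  at mutual distance at least the radius \<open>r\<close>, so every solution has an entry of at
  least \<open>r / 2\<close>. For (b), \<open>out\<close> is an upper bound in every outcome,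
  because a sum dominates \<open>Top l\<close>; only the other direction is probabilistic. The 4 is
  a product of two factors 2: one for joining two agents of a cluster through their optimal center,
  one for sampling proportionally to the weights instead of uniformly within a cluster. The
  logarithm is a harmonic sum, collecting for each sample the loss when it misses the clusters still
  to be served. The obstacle on the program side is that halting, query counts, correctness and an
  expectation all have to be read off one distribution of configurations. They are therefore proved
  by a single kind of judgement, for which loop rules are derived once.\<close>

lemma Top_facts:
  assumes "finite C"
  obtains xs where "Top l C v = sum_list (take l xs)" "mset xs = image_mset v (mset_set C)"
    "sorted_wrt (\<ge>) xs" "length xs = card C"
proof
  let ?xs = "rev (sorted_list_of_multiset (image_mset v (mset_set C)))"
  show "Top l C v = sum_list (take l ?xs)" by (simp add: Top_def)
  show m: "mset ?xs = image_mset v (mset_set C)" by simp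
  show "sorted_wrt (\<ge>) ?xs" by (simp add: sorted_wrt_rev)
  show "length ?xs = card C" using m by (metis size_mset size_image_mset size_mset_set)
qed

lemma set_eq_image_if_mset_eq:
  "finite C \<Longrightarrow> mset xs = image_mset v (mset_set C) \<Longrightarrow> set xs = v ` C"
  by (metis finite_set_mset_mset_set set_image_mset set_mset_mset)

lemma Top_le_mult:
  assumes "finite C" "0 \<le> M" "\<And>i. i \<in> C \<Longrightarrow> v i \<le> M"
  shows "Top l C v \<le> real l * M"
proof -
  obtain xs where xs: "Top l C v = sum_list (take l xs)" "mset xs = image_mset v (mset_set C)"
    using Top_facts[OF assms(1)] by metis
  have "x \<le> M" if "x \<in> set xs" for x
    using that assms(3) set_eq_image_if_mset_eq[OF assms(1) xs(2)] by auto
  then have "sum_list (take l xs) \<le> sum_list (map (\<lambda>_. M) (take l xs))"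
    using sum_list_mono[of "take l xs" "\<lambda>x. x" "\<lambda>_. M"] by (auto dest: in_set_takeD)
  also have "\<dots> = real (min (length xs) l) * M" by (simp add: sum_list_triv)
  also have "\<dots> \<le> real l * M" using assms(2) by (intro mult_right_mono) auto
  finally show ?thesis using xs by simp
qed

text \<open>Since \<open>l \<ge> 1\<close>, the head of the descending list is among the summands;
  the other summands are nonnegative.\<close>

lemma le_Top:
  assumes "finite C" "1 \<le> l" "\<And>i. i \<in> C \<Longrightarrow> 0 \<le> v i" "i \<in> C"
  shows "v i \<le> Top l C v"
proof -
  obtain xs where xs: "Top l C v = sum_list (take l xs)" "mset xs = image_mset v (mset_set C)"
    "sorted_wrt (\<ge>) xs"
    using Top_facts[OF assms(1)] by metis
  note set_xs = set_eq_image_if_mset_eq[OF assms(1) xs(2)]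
  obtain y ys where y: "xs = y # ys" using set_xs assms(4) by (cases xs) auto
  obtain l' where l': "l = Suc l'" using assms(2) by (cases l) auto
  have "v i \<in> set xs" using set_xs assms(4) by simp
  then have "v i \<le> y" using xs(3) y by auto
  moreover have "0 \<le> x" if "x \<in> set xs" for x
    using that set_xs assms(3) by auto
  then have "0 \<le> sum_list (take l' ys)"
    using y by (intro sum_list_nonneg) (auto dest: in_set_takeD)
  ultimately show ?thesis using xs(1) y l' by simp
qed

lemma sum_eq_sum_list_if_mset_eq:
  "finite C \<Longrightarrow> mset xs = image_mset v (mset_set C) \<Longrightarrow> sum v C = (sum_list xs :: real)"
  by (metis sum_mset_sum_list sum_unfold_sum_mset)

lemma Top_le_sum:
  assumes "finite C" "\<And>i. i \<in> C \<Longrightarrow> 0 \<le> v i"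
  shows "Top l C v \<le> sum v C"
proof -
  obtain xs where xs: "Top l C v = sum_list (take l xs)" "mset xs = image_mset v (mset_set C)"
    using Top_facts[OF assms(1)] by metis
  have "0 \<le> x" if "x \<in> set xs" for x
    using that assms(2) set_eq_image_if_mset_eq[OF assms(1) xs(2)] by auto
  then have "0 \<le> sum_list (drop l xs)"
    by (intro sum_list_nonneg) (auto dest: in_set_dropD)
  moreover have "sum_list xs = sum_list (take l xs) + sum_list (drop l xs)"
    by (metis append_take_drop_id sum_list_append)
  ultimately show ?thesis using xs sum_eq_sum_list_if_mset_eq[OF assms(1) xs(2)] by simp
qed

text \<open>The \<open>l\<close>-th largest entry separates the averages of the two parts.\<close>

lemma sum_le_Top:
  assumes "finite C" "1 \<le> l" "l \<le> card C"
  shows "real l * sum v C \<le> real (card C) * Top l C v"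
proof -
  obtain xs where xs: "Top l C v = sum_list (take l xs)" "mset xs = image_mset v (mset_set C)"
    "sorted_wrt (\<ge>) xs" "length xs = card C"
    using Top_facts[OF assms(1)] by metis
  let ?n = "card C" and ?t = "xs ! (l - 1)"
  have ge: "xs ! i \<ge> xs ! j" if "i \<le> j" "j < ?n" for i j
    using xs(3,4) that by (cases "i = j") (auto simp: sorted_wrt_iff_nth_less)
  have "sum_list (map (\<lambda>_. ?t) (take l xs)) \<le> sum_list (map (\<lambda>x. x) (take l xs))"
    using ge assms xs(4) by (intro sum_list_mono) (auto simp: in_set_conv_nth)
  then have 1: "real l * ?t \<le> sum_list (take l xs)"
    using assms(3) xs(4) by (simp add: sum_list_triv min_absorb2)
  have "sum_list (map (\<lambda>x. x) (drop l xs)) \<le> sum_list (map (\<lambda>_. ?t) (drop l xs))"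
    using ge assms xs(4) by (intro sum_list_mono) (auto simp: in_set_conv_nth)
  then have 2: "sum_list (drop l xs) \<le> real (?n - l) * ?t"
    using xs(4) by (simp add: sum_list_triv)
  have "real l * sum v C = real l * sum_list (take l xs) + real l * sum_list (drop l xs)"
    using sum_eq_sum_list_if_mset_eq[OF assms(1) xs(2)]
    by (metis append_take_drop_id distrib_left sum_list_append)
  also have "real l * sum_list (drop l xs) \<le> real (?n - l) * (real l * ?t)"
    using mult_left_mono[OF 2, of "real l"] by (simp add: mult.left_commute)
  also have "\<dots> \<le> real (?n - l) * sum_list (take l xs)"
    using 1 by (intro mult_left_mono) auto
  finally show ?thesis using xs(1) assms(3) by (simp add: of_nat_diff algebra_simps)
qed

section \<open>Feasible center sets and the optimal value\<close>

definition solutions :: "nat \<Rightarrow> nat \<Rightarrow> nat set set" where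
  "solutions n k = {S. S \<subseteq> {..<n} \<and> 1 \<le> card S \<and> card S \<le> k}"

lemma finite_solutions: "finite (solutions n k)"
  unfolding solutions_def by simp

lemma OPT_le:
  "S \<in> solutions n k \<Longrightarrow> OPT {..<n} d k l \<le> Top l {..<n} (\<lambda>i. set_dist d i S)"
  unfolding OPT_def solutions_def[symmetric] by (rule Min_le) (auto simp: finite_solutions)

lemma OPT_attained:
  assumes "1 \<le> k" "k \<le> n"
  obtains S where "S \<in> solutions n k" "OPT {..<n} d k l = Top l {..<n} (\<lambda>i. set_dist d i S)"
proof -
  have "{0} \<in> solutions n k" using assms by (auto simp: solutions_def)
  then have "OPT {..<n} d k l \<in> (\<lambda>S. Top l {..<n} (\<lambda>i. set_dist d i S)) ` solutions n k"
    unfolding OPT_def solutions_def[symmetric] by (intro Min_in) (auto simp: finite_solutions)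
  then show ?thesis using that by auto
qed

lemma set_dist_le: "finite S \<Longrightarrow> c \<in> S \<Longrightarrow> set_dist d i S \<le> d i c"
  unfolding set_dist_def by (rule Min_le) auto

lemma set_dist_attained:
  assumes "finite S" "S \<noteq> {}"
  obtains c where "c \<in> S" "set_dist d i S = d i c"
proof -
  have "set_dist d i S \<in> d i ` S" unfolding set_dist_def using assms by (intro Min_in) auto
  then show ?thesis using that by auto
qed

lemma set_dist_singleton [simp]: "set_dist d i {a} = d i a"
  by (simp add: set_dist_def)

lemma set_dist_insert:
  "finite S \<Longrightarrow> S \<noteq> {} \<Longrightarrow> set_dist d i (insert a S) = min (d i a) (set_dist d i S)"
  by (simp add: set_dist_def)

text \<open>The difference \<open>harm m - ln m\<close> decreases in \<open>m\<close> and equals 1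
  at \<open>m = 1\<close>. Passing from \<open>k - 1\<close> up to \<open>k\<close> keeps the
  logarithm away from 0.\<close>

lemma harm_le: "0 < k \<Longrightarrow> harm (k - 1) \<le> 1 + ln (real k)"
proof -
  assume "0 < k"
  then obtain m where m: "k = Suc m" by (cases k) auto
  have "harm (Suc m) - ln (real (Suc m)) \<le> harm (Suc 0) - ln (real (Suc 0))"
    using decseq_harm_diff_ln by (rule decseqD) simp
  moreover have "harm m \<le> (harm (Suc m) :: real)" by (rule harm_mono) simp
  moreover have "harm (Suc 0) = (1 :: real)" by (simp add: harm_def)
  ultimately show ?thesis using m by simp
qed

section \<open>Covering and separation in the pseudometric\<close>

locale agents =
  fixes n :: nat and d :: "nat \<Rightarrow> nat \<Rightarrow> real"
  assumes pm: "pseudometric_on {..<n} d"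
begin

lemma dist_self: "i < n \<Longrightarrow> d i i = 0"
  and dist_nonneg: "i < n \<Longrightarrow> j < n \<Longrightarrow> 0 \<le> d i j"
  and dist_sym: "i < n \<Longrightarrow> j < n \<Longrightarrow> d i j = d j i"
  and dist_tri: "i < n \<Longrightarrow> j < n \<Longrightarrow> h < n \<Longrightarrow> d i h \<le> d i j + d j h"
  using pm unfolding pseudometric_on_def by (simp, simp, metis lessThan_iff, metis lessThan_iff)

lemma solutionsD:
  assumes "S \<in> solutions n k"
  shows "finite S" "S \<noteq> {}" "\<And>c. c \<in> S \<Longrightarrow> c < n" "card S \<le> k"
  using assms by (auto simp: solutions_def intro: finite_subset)

lemma set_dist_nonneg:
  assumes "S \<in> solutions n k" "i < n"
  shows "0 \<le> set_dist d i S"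
  using set_dist_attained[OF solutionsD(1,2)[OF assms(1)], of d i] solutionsD(3)[OF assms(1)]
    dist_nonneg assms(2) by metis

text \<open>Gives the lower half of (a): each of the \<open>l\<close> summands is at most a covering
  radius.\<close>

lemma OPT_le_radius:
  assumes "S \<in> solutions n k" "0 \<le> r" "\<And>i. i < n \<Longrightarrow> \<exists>c\<in>S. d i c \<le> r"
  shows "OPT {..<n} d k l \<le> real l * r"
proof -
  have "set_dist d i S \<le> r" if "i < n" for i
    using assms(3)[OF that] set_dist_le[OF solutionsD(1)[OF assms(1)]] by (meson order_trans)
  then have "Top l {..<n} (\<lambda>i. set_dist d i S) \<le> real l * r"
    using assms(2) by (intro Top_le_mult) auto
  with OPT_le[OF assms(1)] show ?thesis by (rule order_trans)
qed

text \<open>Among \<open>k + 1\<close> points, two have the same nearest optimal center.\<close>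

lemma separation_le_OPT:
  assumes "1 \<le> k" "k \<le> n" "1 \<le> l" and c: "\<And>j. j \<le> k \<Longrightarrow> c j < n"
    and sep: "\<And>i j. i < j \<Longrightarrow> j \<le> k \<Longrightarrow> r \<le> d (c i) (c j)"
  shows "r \<le> 2 * OPT {..<n} d k l"
proof -
  obtain S where S: "S \<in> solutions n k" "OPT {..<n} d k l = Top l {..<n} (\<lambda>i. set_dist d i S)"
    using OPT_attained assms(1,2) by metis
  note SD = solutionsD[OF S(1)]
  define p where "p j = (SOME a. a \<in> S \<and> set_dist d (c j) S = d (c j) a)" for j
  have p: "p j \<in> S \<and> set_dist d (c j) S = d (c j) (p j)" for j
    unfolding p_def by (rule someI_ex) (metis set_dist_attained[OF SD(1,2)])
  have "card (p ` {..k}) \<le> card S" using p by (intro card_mono SD) auto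
  then have "card (p ` {..k}) < card {..k}" using SD(4) by simp
  then have "\<not> inj_on p {..k}" using pigeonhole by blast
  then obtain i j where ij: "i < j" "j \<le> k" "p i = p j"
    by (metis atMost_iff linorder_inj_onI' )
  \<comment> \<open>A single entry of the optimal distance vector is at most its
    \<open>Top l\<close>, because \<open>l \<ge> 1\<close>.\<close>
  have OPT_ge: "d (c i) (p i) \<le> OPT {..<n} d k l" if "i \<le> k" for i
    using le_Top[of "{..<n}" l "\<lambda>i. set_dist d i S" "c i"] c[OF that] p[of i] S assms(3)
      set_dist_nonneg[OF S(1)] by auto
  have cn: "c i < n" "c j < n" "p i < n" using c ij p SD(3) by auto
  have "r \<le> d (c i) (p i) + d (p i) (c j)"
    using sep[OF ij(1,2)] dist_tri[OF cn(1,3,2)] by simp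
  also have "d (p i) (c j) = d (c j) (p j)" using dist_sym cn ij(3) by metis
  finally show ?thesis using OPT_ge[of i] OPT_ge[of j] ij by simp
qed

section \<open>Expected cost of sampling proportionally to distance\<close>

text \<open>Expected sum of the weights after \<open>t\<close> further centers have been sampled.  If the total
  weight is zero, division by zero yields 0, which is the correct value.\<close>

primrec dsample_cost :: "nat \<Rightarrow> (nat \<Rightarrow> real) \<Rightarrow> real" where
  "dsample_cost 0 w = (\<Sum>i<n. w i)"
| "dsample_cost (Suc t) w =
     (\<Sum>a<n. w a / (\<Sum>i<n. w i) * dsample_cost t (\<lambda>i. min (w i) (d i a)))"

text \<open>Stands in for "distance to a set of centers": nonnegative and 1-Lipschitz. The class is
  closed under adding a center, so the induction over samples never has to mention the
  centers.\<close>

definition weights :: "(nat \<Rightarrow> real) \<Rightarrow> bool" where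
  "weights w \<longleftrightarrow> (\<forall>i<n. 0 \<le> w i) \<and> (\<forall>i<n. \<forall>j<n. w i \<le> w j + d i j)"

lemma weights_min:
  assumes "weights w" "a < n"
  shows "weights (\<lambda>i. min (w i) (d i a))"
  unfolding weights_def
proof (intro conjI allI impI)
  fix i assume "i < n"
  then show "0 \<le> min (w i) (d i a)" using assms dist_nonneg by (auto simp: weights_def)
next
  fix i j assume ij: "i < n" "j < n"
  then have "w i \<le> w j + d i j" "d i a \<le> d i j + d j a"
    using assms dist_tri by (auto simp: weights_def)
  then show "min (w i) (d i a) \<le> min (w j) (d j a) + d i j" by linarith
qed

lemma weights_dist: "a < n \<Longrightarrow> weights (\<lambda>i. d i a)"
  using dist_nonneg dist_tri by (force simp: weights_def add.commute)

lemma dsample_cost_cong: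
  "(\<And>i. i < n \<Longrightarrow> w i = w' i) \<Longrightarrow> dsample_cost t w = dsample_cost t w'"
proof (induction t arbitrary: w w')
  case (Suc t)
  have "dsample_cost t (\<lambda>i. min (w i) (d i a)) = dsample_cost t (\<lambda>i. min (w' i) (d i a))" for a
    using Suc.prems by (intro Suc.IH) simp
  then show ?case using Suc.prems by simp
qed simp

lemma dsample_cost_nonneg: "weights w \<Longrightarrow> 0 \<le> dsample_cost t w"
proof (induction t arbitrary: w)
  case 0
  then show ?case by (auto simp: weights_def intro: sum_nonneg)
next
  case (Suc t)
  then have w: "0 \<le> w i" if "i < n" for i using that by (simp add: weights_def)
  show ?case unfolding dsample_cost.simps
    using w Suc.IH[OF weights_min[OF Suc.prems]]
    by (intro sum_nonneg mult_nonneg_nonneg divide_nonneg_nonneg) auto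
qed

lemma dsample_cost_zero:
  assumes "\<And>i. i < n \<Longrightarrow> w i = 0"
  shows "dsample_cost t w = 0"
proof (cases t)
  case (Suc t')
  then show ?thesis using assms by (auto intro: sum.neutral)
qed (use assms in simp)

text \<open>Average \<open>w a \<le> w i + d i a\<close> over \<open>i \<in> A\<close>, then bound the minimum by one argument or the
  other.\<close>

lemma cluster_sampling:
  assumes w: "weights w" and A: "A \<subseteq> {..<n}"
    and b: "(\<Sum>a\<in>A. \<Sum>i\<in>A. d i a) \<le> 2 * real (card A) * b"
  shows "(\<Sum>a\<in>A. w a * (\<Sum>i\<in>A. min (w i) (d i a))) \<le> 4 * b * (\<Sum>a\<in>A. w a)"
proof (cases "A = {}")
  case False
  have fin: "finite A" using A finite_subset by blast
  with False have cA: "0 < real (card A)" by (simp add: card_gt_0_iff)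
  define W where "W = (\<Sum>a\<in>A. w a)"
  have w0: "0 \<le> w a" if "a \<in> A" for a using w A that by (auto simp: weights_def)
  then have W0: "0 \<le> W" unfolding W_def by (intro sum_nonneg) auto
  have d0: "0 \<le> d i a" if "a \<in> A" "i \<in> A" for a i using A that by (auto intro: dist_nonneg)
  have "real (card A) * (\<Sum>a\<in>A. w a * (\<Sum>i\<in>A. min (w i) (d i a)))
      = (\<Sum>a\<in>A. (real (card A) * w a) * (\<Sum>i\<in>A. min (w i) (d i a)))"
    by (simp add: sum_distrib_left mult.assoc)
  also have "\<dots> \<le> (\<Sum>a\<in>A. (W + (\<Sum>i\<in>A. d i a)) * (\<Sum>i\<in>A. min (w i) (d i a)))"
  proof (intro sum_mono mult_right_mono)
    fix a assume a: "a \<in> A"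
    have "(\<Sum>i\<in>A. w a) \<le> (\<Sum>i\<in>A. w i + d i a)"
    proof (rule sum_mono)
      fix i assume "i \<in> A"
      then have "a < n" "i < n" using a A by auto
      then have "w a \<le> w i + d a i" "d a i = d i a"
        using w dist_sym by (simp add: weights_def, blast)
      then show "w a \<le> w i + d i a" by simp
    qed
    then show "real (card A) * w a \<le> W + (\<Sum>i\<in>A. d i a)"
      by (simp add: W_def sum.distrib)
    show "0 \<le> (\<Sum>i\<in>A. min (w i) (d i a))"
      using w0 d0 a by (intro sum_nonneg) auto
  qed
  also have "\<dots> \<le> (\<Sum>a\<in>A. 2 * W * (\<Sum>i\<in>A. d i a))"
  proof (rule sum_mono)
    fix a assume a: "a \<in> A"
    have "(\<Sum>i\<in>A. min (w i) (d i a)) \<le> W" "(\<Sum>i\<in>A. min (w i) (d i a)) \<le> (\<Sum>i\<in>A. d i a)"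
      unfolding W_def by (auto intro: sum_mono)
    moreover have "0 \<le> (\<Sum>i\<in>A. d i a)" using d0 a by (intro sum_nonneg) auto
    ultimately have "W * (\<Sum>i\<in>A. min (w i) (d i a)) \<le> W * (\<Sum>i\<in>A. d i a)"
      "(\<Sum>i\<in>A. d i a) * (\<Sum>i\<in>A. min (w i) (d i a)) \<le> (\<Sum>i\<in>A. d i a) * W"
      using W0 by (auto intro: mult_left_mono)
    then show "(W + (\<Sum>i\<in>A. d i a)) * (\<Sum>i\<in>A. min (w i) (d i a)) \<le> 2 * W * (\<Sum>i\<in>A. d i a)"
      by (simp add: algebra_simps)
  qed
  also have "\<dots> = 2 * W * (\<Sum>a\<in>A. \<Sum>i\<in>A. d i a)" by (simp add: sum_distrib_left)
  \<comment> \<open>The final 4 is the 2 in the hypothesis on \<open>b\<close> times the 2 from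
    adding the two products above.\<close>
  also have "\<dots> \<le> 2 * W * (2 * real (card A) * b)" using b W0 by (intro mult_left_mono) auto
  finally have "real (card A) * (\<Sum>a\<in>A. w a * (\<Sum>i\<in>A. min (w i) (d i a)))
      \<le> real (card A) * (4 * b * W)" by (simp add: mult_ac)
  then show ?thesis using cA by (simp add: W_def)
qed simp

text \<open>The induction of Arthur and Vassilvitskii for k-means++.  The clusters in \<open>U\<close> play the role
  of the uncovered ones, but nothing about being uncovered is needed.  The difference
  \<open>card U - t\<close> is truncated, so \<open>t\<close> may exceed \<open>card U\<close>.\<close>

lemma dsample_cost_bound:
  assumes "finite U" "disjoint U" "\<And>A. A \<in> U \<Longrightarrow> A \<subseteq> {..<n}" "weights w"
    and "\<And>A. A \<in> U \<Longrightarrow> (\<Sum>a\<in>A. \<Sum>i\<in>A. d i a) \<le> 2 * real (card A) * b A"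
    and "\<And>A. A \<in> U \<Longrightarrow> 0 \<le> b A"
  shows "dsample_cost t w \<le> ((\<Sum>i\<in>{..<n} - \<Union>U. w i) + 4 * (\<Sum>A\<in>U. b A)) * (1 + harm t)
     + real (card U - t) / real (card U) * (\<Sum>i\<in>\<Union>U. w i)"
  using assms
proof (induction t arbitrary: U w)
  case (0 U w)
  have UU: "\<Union>U \<subseteq> {..<n}" using 0(3) by blast
  have "(\<Sum>i<n. w i) = (\<Sum>i\<in>{..<n} - \<Union>U. w i) + (\<Sum>i\<in>\<Union>U. w i)"
    using UU by (intro sum.subset_diff) auto
  moreover have "0 \<le> (\<Sum>A\<in>U. b A)" using 0(6) by (rule sum_nonneg)
  \<comment> \<open>For nonempty \<open>U\<close> the last coefficient is 1; for empty
    \<open>U\<close> it is \<open>0 / 0 = 0\<close>, in front of an empty sum.\<close>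
  ultimately show ?case using 0(1) by (cases "U = {}") (simp_all add: harm_def)
next
  case (Suc t U w)
  let ?u = "card U"
  define P where "P = {..<n} - \<Union>U"
  define c where "c = (\<Sum>i\<in>P. w i)"
  define v where "v = (\<Sum>i\<in>\<Union>U. w i)"
  define bU where "bU = (\<Sum>A\<in>U. b A)"
  define vA where "vA A = (\<Sum>i\<in>A. w i)" for A
  define E where "E = (c + 4 * bU) * (1 + harm t)"
  \<comment> \<open>\<open>r\<close> is the coefficient wanted for \<open>Suc t\<close>;
    \<open>r1\<close> and \<open>r2\<close> are those the induction hypothesis supplies with
    \<open>U\<close> unchanged and with one cluster removed.\<close>
  define r where "r = real (?u - Suc t) / real ?u"
  define r1 where "r1 = real (?u - t) / real ?u"
  define r2 where "r2 = real (?u - Suc t) / real (?u - 1)"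
  define D where "D a = dsample_cost t (\<lambda>i. min (w i) (d i a))" for a
  have UU: "\<Union>U \<subseteq> {..<n}" using Suc(4) by blast
  have fin: "finite A" if "A \<in> U" for A using Suc(4)[OF that] finite_subset by blast
  have w0: "0 \<le> w i" if "i < n" for i using Suc(5) that by (simp add: weights_def)
  have disj: "\<forall>A\<in>U. \<forall>B\<in>U. A \<noteq> B \<longrightarrow> A \<inter> B = {}" using Suc(3) by (auto simp: disjoint_def)
  have vsum: "v = (\<Sum>A\<in>U. vA A)"
    unfolding v_def vA_def[abs_def] using sum.Union_disjoint[of U w] fin disj by simp
  have c0: "0 \<le> c" unfolding c_def P_def using w0 by (intro sum_nonneg) auto
  have vA0: "0 \<le> vA A" if "A \<in> U" for A unfolding vA_def using w0 Suc(4)[OF that] by (intro sum_nonneg) auto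
  then have v0: "0 \<le> v" unfolding vsum by (intro sum_nonneg)
  have o0: "0 \<le> bU" unfolding bU_def using Suc(7) by (rule sum_nonneg)
  have H0: "0 \<le> (harm t :: real)" by (rule harm_nonneg)
  have r0: "0 \<le> r" unfolding r_def by simp
  have split: "(\<Sum>a<n. f a) = (\<Sum>a\<in>P. f a) + (\<Sum>A\<in>U. \<Sum>a\<in>A. f a)" for f :: "nat \<Rightarrow> real"
  proof -
    have "(\<Sum>a<n. f a) = (\<Sum>a\<in>P. f a) + (\<Sum>a\<in>\<Union>U. f a)"
      unfolding P_def using UU by (intro sum.subset_diff) auto
    also have "(\<Sum>a\<in>\<Union>U. f a) = (\<Sum>A\<in>U. \<Sum>a\<in>A. f a)"
      using sum.Union_disjoint[of U f] fin disj by (simp add: comp_def)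
    finally show ?thesis .
  qed
  have phi: "(\<Sum>a<n. w a) = c + v" unfolding split c_def vsum vA_def by simp
  have goal: "dsample_cost (Suc t) w \<le> (c + 4 * bU) * (1 + harm (Suc t)) + r * v"
  proof (cases "c + v = 0")
    case True
    then have "dsample_cost (Suc t) w = 0" using phi by simp
    moreover have "0 \<le> (c + 4 * bU) * (1 + harm (Suc t)) + r * v"
      using c0 o0 v0 r0 harm_nonneg[of "Suc t", where ?'a = real] by (intro add_nonneg_nonneg mult_nonneg_nonneg) auto
    ultimately show ?thesis by simp
  next
    case False
    then have pos: "0 < c + v" using c0 v0 by simp
    \<comment> \<open>A sample outside the clusters keeps \<open>U\<close>; taking minima only
      lowers the sums.\<close>
    have DP: "D a \<le> E + r1 * v" if "a \<in> P" for a
    proof -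
      have "D a \<le> ((\<Sum>i\<in>P. min (w i) (d i a)) + 4 * bU) * (1 + harm t)
         + r1 * (\<Sum>i\<in>\<Union>U. min (w i) (d i a))"
        unfolding D_def P_def bU_def r1_def using that Suc(2-7) weights_min
        by (intro Suc.IH) (auto simp: P_def)
      also have "\<dots> \<le> (c + 4 * bU) * (1 + harm t) + r1 * v"
        unfolding c_def v_def using H0
        by (intro add_mono mult_right_mono mult_left_mono sum_mono) (auto simp: r1_def)
      finally show ?thesis by (simp add: E_def)
    qed
    \<comment> \<open>A sample in \<open>A\<close> removes \<open>A\<close> from \<open>U\<close>,
      so that the points of \<open>A\<close> now count among those outside.\<close>
    have DU: "(\<Sum>a\<in>A. w a * D a) \<le> vA A * (E + r2 * (v - vA A))" if A: "A \<in> U" for A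
    proof -
      let ?m = "\<lambda>a. \<Sum>i\<in>A. min (w i) (d i a)"
      let ?K = "(c + 4 * (bU - b A)) * (1 + harm t) + r2 * (v - vA A)"
      have AU: "{..<n} - \<Union>(U - {A}) = P \<union> A" "P \<inter> A = {}"
        using disj A Suc(4)[OF A] unfolding P_def by auto
      have cU: "card (U - {A}) = ?u - 1" using Suc(2) A by simp
      have UA: "\<Union>(U - {A}) = \<Union>U - A" using disj A by auto
      have D: "D a \<le> ?K + (1 + harm t) * ?m a" if a: "a \<in> A" for a
      proof -
        have "a < n" using a A Suc(4) by auto
        then have "D a \<le> ((\<Sum>i\<in>P \<union> A. min (w i) (d i a)) + 4 * (\<Sum>B\<in>U - {A}. b B)) * (1 + harm t)
          + real (card (U - {A}) - t) / real (card (U - {A})) * (\<Sum>i\<in>\<Union>U - A. min (w i) (d i a))"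
          unfolding D_def UA[symmetric] AU(1)[symmetric] using Suc(2-7) weights_min
          by (intro Suc.IH) (auto simp: disjoint_def)
        also have "(\<Sum>i\<in>P \<union> A. min (w i) (d i a)) = (\<Sum>i\<in>P. min (w i) (d i a)) + ?m a"
          using AU(2) fin[OF A] by (intro sum.union_disjoint) (auto simp: P_def)
        also have "(\<Sum>B\<in>U - {A}. b B) = bU - b A"
          unfolding bU_def using Suc(2) A by (simp add: sum_diff1)
        also have "real (card (U - {A}) - t) / real (card (U - {A})) = r2"
          unfolding cU r2_def by simp
        also have "((\<Sum>i\<in>P. min (w i) (d i a)) + ?m a + 4 * (bU - b A)) * (1 + harm t)
          + r2 * (\<Sum>i\<in>\<Union>U - A. min (w i) (d i a))
          \<le> (c + ?m a + 4 * (bU - b A)) * (1 + harm t) + r2 * (\<Sum>i\<in>\<Union>U - A. w i)"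
          unfolding c_def using H0
          by (intro add_mono mult_right_mono mult_left_mono sum_mono) (auto simp: r2_def)
        also have "(\<Sum>i\<in>\<Union>U - A. w i) = v - vA A"
          unfolding v_def vA_def using A fin Suc(2) by (intro sum_diff) auto
        finally show ?thesis by (simp add: algebra_simps)
      qed
      have "(\<Sum>a\<in>A. w a * D a) \<le> (\<Sum>a\<in>A. w a * (?K + (1 + harm t) * ?m a))"
        using D w0 Suc(4)[OF A] by (intro sum_mono mult_left_mono) auto
      also have "\<dots> = vA A * ?K + (1 + harm t) * (\<Sum>a\<in>A. w a * ?m a)"
        unfolding vA_def sum_distrib_left sum_distrib_right sum.distrib[symmetric]
        by (intro sum.cong) (auto simp: algebra_simps sum_distrib_left)
      also have "\<dots> \<le> vA A * ?K + (1 + harm t) * (4 * b A * vA A)"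
        unfolding vA_def using cluster_sampling[OF Suc(5) Suc(4)[OF A] Suc(6)[OF A]] H0
        by (intro add_left_mono mult_left_mono) auto
      \<comment> \<open>The \<open>4 * b A\<close> from sampling inside \<open>A\<close> replaces
        the one lost when \<open>A\<close> left \<open>U\<close>, which completes
        \<open>E\<close>.\<close>
      also have "\<dots> = vA A * (E + r2 * (v - vA A))"
        by (simp add: E_def algebra_simps)
      finally show ?thesis .
    qed
    \<comment> \<open>Cauchy-Schwarz over the clusters yields the factor
      \<open>(?u - 1) / ?u\<close>, which turns \<open>r2\<close> into \<open>r\<close>. With at
      most one cluster, \<open>r2\<close> is 0.\<close>
    have cs: "r2 * (v * v - (\<Sum>A\<in>U. vA A * vA A)) \<le> r * (v * v)"
    proof (cases "?u \<le> 1")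
      case True
      then show ?thesis using r0 by (simp add: r2_def)
    next
      case False
      have "v\<^sup>2 \<le> real ?u * (\<Sum>A\<in>U. (vA A)\<^sup>2)"
        unfolding vsum using sum_squared_le_sum_of_squares[of vA U] by (simp add: mult.commute)
      then have "real ?u * (v * v - (\<Sum>A\<in>U. vA A * vA A)) \<le> real (?u - 1) * (v * v)"
        using False by (simp add: power2_eq_square algebra_simps of_nat_diff)
      then have "v * v - (\<Sum>A\<in>U. vA A * vA A) \<le> real (?u - 1) / real ?u * (v * v)"
        using False by (simp add: field_simps)
      then have "r2 * (v * v - (\<Sum>A\<in>U. vA A * vA A)) \<le> r2 * (real (?u - 1) / real ?u * (v * v))"
        by (intro mult_left_mono) (auto simp: r2_def)
      also have "\<dots> = r * (v * v)" using False by (simp add: r_def r2_def)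
      finally show ?thesis .
    qed
    \<comment> \<open>A sample outside \<open>U\<close> wastes a round. For \<open>t < ?u\<close>
      this costs \<open>1 / ?u\<close>, at most the next harmonic term; otherwise both coefficients
      are 0.\<close>
    have r1: "r1 \<le> r + 1 / real (Suc t)"
    proof (cases "t < ?u")
      case True
      have "r1 = r + 1 / real ?u" using True by (simp add: r1_def r_def of_nat_diff field_simps)
      also have "1 / real ?u \<le> 1 / real (Suc t)" using True by (intro divide_left_mono) auto
      finally show ?thesis by simp
    qed (simp add: r1_def r_def)
    have "(c + v) * dsample_cost (Suc t) w = (\<Sum>a<n. w a * D a)"
      unfolding dsample_cost.simps phi D_def[symmetric] using pos by (simp add: sum_distrib_left)
    also have "\<dots> \<le> (\<Sum>a\<in>P. w a * (E + r1 * v)) + (\<Sum>A\<in>U. vA A * (E + r2 * (v - vA A)))"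
      unfolding split using DP DU w0
      by (intro add_mono sum_mono mult_left_mono) (auto simp: P_def)
    also have "(\<Sum>a\<in>P. w a * (E + r1 * v)) = c * (E + r1 * v)"
      by (simp add: c_def sum_distrib_right)
    also have "(\<Sum>A\<in>U. vA A * (E + r2 * (v - vA A))) = v * E + r2 * (v * v - (\<Sum>A\<in>U. vA A * vA A))"
      unfolding vsum by (simp add: algebra_simps sum.distrib sum_subtractf sum_distrib_left sum_distrib_right)
    also have "c * (E + r1 * v) + (v * E + r2 * (v * v - (\<Sum>A\<in>U. vA A * vA A)))
      \<le> c * (E + (r + 1 / real (Suc t)) * v) + (v * E + r * (v * v))"
      using cs r1 c0 v0 by (intro add_mono mult_left_mono mult_right_mono) auto
    also have "\<dots> = (c + v) * (E + r * v) + c / real (Suc t) * v" by (simp add: algebra_simps)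
    \<comment> \<open>Enlarging \<open>c * v\<close> lets the factor \<open>c + v\<close> be
      cancelled; the remaining \<open>(c + 4 * bU) / Suc t\<close> extends \<open>harm t\<close> to
      \<open>harm (Suc t)\<close>.\<close>
    also have "\<dots> \<le> (c + v) * (E + r * v) + (c + 4 * bU) / real (Suc t) * (c + v)"
      using c0 v0 o0 by (intro add_left_mono mult_mono divide_right_mono) auto
    also have "\<dots> = (c + v) * ((c + 4 * bU) * (1 + harm (Suc t)) + r * v)"
      unfolding E_def harm_Suc by (simp add: divide_inverse algebra_simps del: of_nat_Suc)
    finally show ?thesis using pos by simp
  qed
  then show ?case by (simp add: c_def v_def bU_def r_def P_def)
qed

text \<open>Partition the agents by their nearest center in \<open>S\<close>. If the uniform first
  center falls in cluster \<open>A\<close>, the preceding bound is applied to the remaining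
  clusters, with \<open>A\<close> as the part outside; averaging over \<open>a \<in> A\<close>
  bounds the cost of \<open>A\<close> itself.\<close>

lemma dsample_cost_expected:
  assumes k: "1 \<le> k" "k \<le> n" and S: "S \<in> solutions n k"
  shows "(\<Sum>a<n. dsample_cost (k - 1) (\<lambda>i. d i a)) / real n
    \<le> 4 * (ln (real k) + 2) * (\<Sum>i<n. set_dist d i S)"
proof -
  note SD = solutionsD[OF S]
  define f where "f i = set_dist d i S" for i
  define p where "p i = (SOME a. a \<in> S \<and> f i = d i a)" for i
  have p: "p i \<in> S \<and> f i = d i (p i)" for i
    unfolding p_def f_def by (rule someI_ex) (metis set_dist_attained[OF SD(1,2)])
  have f0: "0 \<le> f i" if "i < n" for i using set_dist_nonneg[OF S that] by (simp add: f_def)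
  define cl where "cl c = {i \<in> {..<n}. p i = c}" for c
  define \<A> where "\<A> = cl ` (p ` {..<n})"
  define b where "b A = (\<Sum>i\<in>A. f i)" for A
  define H where "H = 1 + (harm (k - 1) :: real)"
  have H0: "0 \<le> H" unfolding H_def using harm_nonneg[of "k - 1", where ?'a = real] by simp
  have finA: "finite \<A>" unfolding \<A>_def by simp
  have sub: "A \<subseteq> {..<n}" if "A \<in> \<A>" for A using that by (auto simp: \<A>_def cl_def)
  have fin: "finite A" if "A \<in> \<A>" for A using sub[OF that] finite_subset by blast
  have disj: "disjoint \<A>" by (auto simp: \<A>_def cl_def disjoint_def)
  have UA: "\<Union>\<A> = {..<n}" by (auto simp: \<A>_def cl_def)
  have b0: "0 \<le> b A" if "A \<in> \<A>" for A unfolding b_def using f0 sub[OF that] by (intro sum_nonneg) auto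
  have "card \<A> \<le> card (p ` {..<n})" unfolding \<A>_def by (rule card_image_le) simp
  also have "\<dots> \<le> card S" using p by (intro card_mono SD(1)) auto
  finally have cA: "card \<A> \<le> k" using SD(4) by simp
  have sums: "(\<Sum>i<n. g i) = (\<Sum>A\<in>\<A>. \<Sum>i\<in>A. g i)" for g :: "nat \<Rightarrow> real"
    using sum.Union_disjoint[of \<A> g] fin disj UA by (auto simp: disjoint_def)
  \<comment> \<open>Two agents of a cluster are joined through their common center. Each
    \<open>f i\<close> is counted \<open>card A\<close> times in either role, whence the 2.\<close>
  have cl2: "(\<Sum>a\<in>A. \<Sum>i\<in>A. d i a) \<le> 2 * real (card A) * b A" if A: "A \<in> \<A>" for A
  proof -
    have "(\<Sum>a\<in>A. \<Sum>i\<in>A. d i a) \<le> (\<Sum>a\<in>A. \<Sum>i\<in>A. f i + f a)"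
    proof (intro sum_mono)
      fix a i assume "a \<in> A" "i \<in> A"
      then have ai: "a < n" "i < n" "p a = p i" using A by (auto simp: \<A>_def cl_def)
      have pn: "p i < n" using p SD(3) by blast
      show "d i a \<le> f i + f a"
        using dist_tri[OF ai(2) pn ai(1)] dist_sym[OF pn ai(1)] p[of i] p[of a] ai(3) by simp
    qed
    also have "\<dots> = 2 * real (card A) * b A"
      by (simp add: sum.distrib b_def flip: sum_distrib_left)
    finally show ?thesis .
  qed
  have bound: "(\<Sum>a\<in>A. dsample_cost (k - 1) (\<lambda>i. d i a)) \<le> (\<Sum>a\<in>A. 4 * (\<Sum>B\<in>\<A>. b B) * H)"
    if A: "A \<in> \<A>" for A
  proof -
    let ?o = "\<Sum>B\<in>\<A> - {A}. b B"
    have compl: "{..<n} - \<Union>(\<A> - {A}) = A"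
      using UA disj A by (auto simp: disjoint_def)
    have le: "dsample_cost (k - 1) (\<lambda>i. d i a) \<le> ((\<Sum>i\<in>A. d i a) + 4 * ?o) * H" if "a \<in> A" for a
    proof -
      have "a < n" using that A sub by auto
      then have "dsample_cost (k - 1) (\<lambda>i. d i a) \<le>
        ((\<Sum>i\<in>{..<n} - \<Union>(\<A> - {A}). d i a) + 4 * ?o) * (1 + harm (k - 1))
        + real (card (\<A> - {A}) - (k - 1)) / real (card (\<A> - {A})) * (\<Sum>i\<in>\<Union>(\<A> - {A}). d i a)"
        using finA disj sub weights_dist cl2 b0
        by (intro dsample_cost_bound) (auto simp: disjoint_def)
      \<comment> \<open>At most \<open>k - 1\<close> clusters remain for \<open>k - 1\<close>
        samples, so the term for unserved clusters vanishes.\<close>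
      moreover have "card (\<A> - {A}) - (k - 1) = 0" using cA A finA by simp
      ultimately show ?thesis unfolding compl H_def by simp
    qed
    have "(\<Sum>a\<in>A. dsample_cost (k - 1) (\<lambda>i. d i a)) \<le> (\<Sum>a\<in>A. ((\<Sum>i\<in>A. d i a) + 4 * ?o) * H)"
      using le by (rule sum_mono)
    also have "\<dots> = ((\<Sum>a\<in>A. \<Sum>i\<in>A. d i a) + real (card A) * (4 * ?o)) * H"
      by (simp add: sum.distrib flip: sum_distrib_right)
    also have "\<dots> \<le> (real (card A) * (4 * b A) + real (card A) * (4 * ?o)) * H"
    proof -
      \<comment> \<open>The uniform first center costs only a factor 2; relaxing it to 4 lets
        \<open>A\<close> join the other clusters in one sum.\<close>
      have "2 * real (card A) * b A \<le> real (card A) * (4 * b A)"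
        using mult_nonneg_nonneg[OF of_nat_0_le_iff b0[OF A], of "card A"] by (simp add: algebra_simps)
      then show ?thesis using order_trans[OF cl2[OF A]] H0 by (intro mult_right_mono add_right_mono) auto
    qed
    also have "\<dots> = real (card A) * (4 * (b A + ?o) * H)" by (simp add: algebra_simps)
    also have "b A + ?o = (\<Sum>B\<in>\<A>. b B)" using finA A by (simp add: sum.remove)
    finally show ?thesis by simp
  qed
  have tot: "(\<Sum>B\<in>\<A>. b B) = (\<Sum>i<n. f i)" unfolding sums b_def by simp
  have "(\<Sum>a<n. dsample_cost (k - 1) (\<lambda>i. d i a)) \<le> (\<Sum>a<n. 4 * (\<Sum>i<n. f i) * H)"
    unfolding sums[of "\<lambda>a. dsample_cost (k - 1) (\<lambda>i. d i a)"] sums[of "\<lambda>a. 4 * (\<Sum>i<n. f i) * H"]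
    using sum_mono[OF bound] unfolding tot by simp
  then have "(\<Sum>a<n. dsample_cost (k - 1) (\<lambda>i. d i a)) / real n \<le> 4 * (\<Sum>i<n. f i) * H"
    using k by (simp add: field_simps)
  also have "\<dots> \<le> 4 * (\<Sum>i<n. f i) * (2 + ln (real k))"
    using harm_le[of k] k f0 unfolding H_def
    by (intro mult_left_mono) (auto intro: sum_nonneg)
  finally show ?thesis by (simp add: f_def algebra_simps)
qed

end

section \<open>Weakest preexpectations for mechanisms\<close>

abbreviation "nvar x \<equiv> NVar x (NConst 0)"
abbreviation "rvar x \<equiv> RVar x (NConst 0)"

lemma nmem_set_nmem [simp]:
  "nmem (set_nmem x j v s) y i = (if y = x \<and> i = j then v else nmem s y i)"
  by (simp add: set_nmem_def)

lemma rmem_set_nmem [simp]: "rmem (set_nmem x j v s) = rmem s"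
  by (simp add: set_nmem_def)

lemma queries_set_nmem [simp]: "queries (set_nmem x j v s) = queries s"
  by (simp add: set_nmem_def)

lemma rmem_set_rmem [simp]:
  "rmem (set_rmem x j v s) y i = (if y = x \<and> i = j then v else rmem s y i)"
  by (simp add: set_rmem_def)

lemma nmem_set_rmem [simp]: "nmem (set_rmem x j v s) = nmem s"
  by (simp add: set_rmem_def)

lemma queries_set_rmem [simp]: "queries (set_rmem x j v s) = queries s"
  by (simp add: set_rmem_def)

definition qcount :: "state \<Rightarrow> nat \<Rightarrow> nat" where
  "qcount s i = length (filter (\<lambda>q. fst q = i) (queries s))"

lemma qcount_set_nmem [simp]: "qcount (set_nmem x j v s) = qcount s"
  by (simp add: qcount_def fun_eq_iff)

lemma qcount_set_rmem [simp]: "qcount (set_rmem x j v s) = qcount s"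
  by (simp add: qcount_def fun_eq_iff)

lemma qcount_query [simp]:
  "qcount (s\<lparr>queries := (a, b) # queries s'\<rparr>) i = (if i = a then Suc (qcount s' i) else qcount s' i)"
  by (simp add: qcount_def)

text \<open>The bound \<open>e\<close> is evaluated anew at every test, so loop invariants have to
  fix its value.\<close>

definition For :: "vname \<Rightarrow> nexp \<Rightarrow> com \<Rightarrow> com" where
  "For x e c = Seq (NAssign x (NConst 0) (NConst 0))
     (While (NLess (NVar x (NConst 0)) e)
       (Seq c (NAssign x (NConst 0) (NAdd (NVar x (NConst 0)) (NConst 1)))))"

lemma ennreal_convex_combination:
  "0 \<le> p \<Longrightarrow> p \<le> 1 \<Longrightarrow> 0 \<le> x \<Longrightarrow> 0 \<le> y \<Longrightarrow>
    ennreal p * ennreal x + ennreal (1 - p) * ennreal y = ennreal (p * x + (1 - p) * y)"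
  by (simp add: ennreal_mult[symmetric] ennreal_plus[symmetric] del: ennreal_plus)

text \<open>Markov's inequality for the strict event \<open>2 * \<mu> < h\<close>. For
  \<open>\<mu> = 0\<close> one cannot divide by \<open>\<mu>\<close>; there the integral forces
  \<open>h = 0\<close> almost surely.\<close>

lemma pmf_Markov_half:
  fixes h :: "'a \<Rightarrow> ennreal"
  assumes "(\<integral>\<^sup>+ x. h x \<partial>measure_pmf p) \<le> ennreal \<mu>" "0 \<le> \<mu>"
  shows "1 / 2 \<le> measure_pmf.prob p {x. h x \<le> ennreal (2 * \<mu>)}"
proof (cases "\<mu> = 0")
  case True
  then have "AE x in measure_pmf p. h x = 0"
    using assms(1) by (simp add: nn_integral_0_iff_AE)
  then have "measure_pmf.prob p {x. h x \<le> ennreal (2 * \<mu>)} = 1"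
    by (subst measure_pmf.prob_eq_1) (auto simp: AE_measure_pmf_iff)
  then show ?thesis by simp
next
  case False
  with assms(2) have pos: "0 < \<mu>" by simp
  let ?B = "{x. ennreal (2 * \<mu>) < h x}"
  have "ennreal (2 * \<mu>) * emeasure (measure_pmf p) ?B = (\<integral>\<^sup>+ x. ennreal (2 * \<mu>) * indicator ?B x \<partial>measure_pmf p)"
    by (simp add: nn_integral_cmult)
  also have "\<dots> \<le> (\<integral>\<^sup>+ x. h x \<partial>measure_pmf p)"
    by (intro nn_integral_mono) (auto simp: indicator_def)
  also have "\<dots> \<le> ennreal \<mu>" by (rule assms(1))
  finally have "ennreal (2 * \<mu> * measure_pmf.prob p ?B) \<le> ennreal \<mu>"
    using pos by (simp add: measure_pmf.emeasure_eq_measure ennreal_mult)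
  then have "measure_pmf.prob p ?B \<le> 1 / 2" using pos by (simp add: ennreal_le_iff)
  moreover have "{x. h x \<le> ennreal (2 * \<mu>)} = UNIV - ?B" by auto
  ultimately show ?thesis
    using measure_pmf.prob_compl[of ?B p] by simp
qed

section \<open>Preexpectations within a step bound\<close>

locale machine =
  fixes n :: nat and \<sigma> :: "nat \<Rightarrow> nat rel" and d :: "nat \<Rightarrow> nat \<Rightarrow> real"
begin

text \<open>Weakest preexpectation with time bound: not halting within \<open>t\<close> steps, or violating a
  property guarded by \<open>\<top>\<close> in \<open>f\<close>, costs \<open>\<top>\<close>.  A single finite upper bound thus yields
  termination, almost sure correctness and the expectation.\<close>

definition wpt :: "nat \<Rightarrow> com \<Rightarrow> (state \<Rightarrow> ennreal) \<Rightarrow> state \<Rightarrow> ennreal" where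
  "wpt t c f s =
     (\<integral>\<^sup>+ cs. (if fst cs = SKIP then f (snd cs) else \<top>) \<partial>measure_pmf (steps n \<sigma> d t (c, s)))"

lemma wpt_0: "wpt 0 c f s = (if c = SKIP then f s else \<top>)"
  by (simp add: wpt_def nn_integral_return_pmf)

lemma wpt_Suc:
  "wpt (Suc t) c f s = (\<integral>\<^sup>+ cs. wpt t (fst cs) f (snd cs) \<partial>measure_pmf (step n \<sigma> d c s))"
  by (simp add: wpt_def)

lemma wpt_SKIP [simp]: "wpt t SKIP f s = f s"
  by (induction t) (simp_all add: wpt_0 wpt_Suc nn_integral_return_pmf)

lemma wpt_mono: "(\<And>s. f s \<le> g s) \<Longrightarrow> wpt t c f s \<le> wpt t c g s"
  unfolding wpt_def by (rule nn_integral_mono) auto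

text \<open>An unfinished run is charged \<open>\<top>\<close> and a halted one no longer moves, so
  more time can only lower the value. Hence generous time bounds are always admissible.\<close>

lemma wpt_Suc_le: "wpt (Suc t) c f s \<le> wpt t c f s"
proof (induction t arbitrary: c s)
  case 0
  show ?case by (cases "c = SKIP") (simp_all add: wpt_0)
next
  case (Suc t)
  show ?case
    by (subst (1 2) wpt_Suc) (rule nn_integral_mono, rule Suc.IH)
qed

lemma wpt_time_mono: "t \<le> t' \<Longrightarrow> wpt t' c f s \<le> wpt t c f s"
  by (induction t' rule: dec_induct) (auto intro: order_trans[OF wpt_Suc_le])

text \<open>The extra step passes from \<open>Seq SKIP c2\<close> to \<open>c2\<close>. Only an
  inequality holds, because \<open>c1\<close> may halt early and leave \<open>c2\<close> more
  time.\<close>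

lemma wpt_Seq: "wpt (Suc (t1 + t2)) (Seq c1 c2) f s \<le> wpt t1 c1 (wpt t2 c2 f) s"
proof (induction t1 arbitrary: c1 s)
  case 0
  show ?case by (cases "c1 = SKIP") (simp_all add: wpt_0 wpt_Suc nn_integral_return_pmf)
next
  case (Suc t)
  show ?case
  proof (cases "c1 = SKIP")
    case True
    then have "wpt (Suc (Suc t + t2)) (Seq c1 c2) f s = wpt (Suc (t + t2)) c2 f s"
      by (subst wpt_Suc) (simp add: nn_integral_return_pmf)
    also have "\<dots> \<le> wpt t2 c2 f s" by (rule wpt_time_mono) simp
    finally show ?thesis using True by simp
  next
    case False
    then have "wpt (Suc (Suc t + t2)) (Seq c1 c2) f s =
      (\<integral>\<^sup>+ cs. wpt (Suc (t + t2)) (Seq (fst cs) c2) f (snd cs) \<partial>measure_pmf (step n \<sigma> d c1 s))"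
      by (subst wpt_Suc) (simp add: case_prod_unfold)
    also have "\<dots> \<le> wpt (Suc t) c1 (wpt t2 c2 f) s"
      by (subst wpt_Suc) (rule nn_integral_mono, rule Suc.IH)
    finally show ?thesis .
  qed
qed

lemma wpt_SeqI:
  assumes "wpt t1 c1 g s \<le> v" "\<And>s'. wpt t2 c2 f s' \<le> g s'"
  shows "wpt (Suc (t1 + t2)) (Seq c1 c2) f s \<le> v"
  using wpt_Seq wpt_mono[OF assms(2)] assms(1) by (meson order_trans)

text \<open>A syntactic upper bound for loop-free code, which simplification evaluates. Loops get
  the trivial bound \<open>\<top>\<close>, and so does a coin whose ratio would be clipped.\<close>

primrec wp :: "com \<Rightarrow> (state \<Rightarrow> ennreal) \<Rightarrow> state \<Rightarrow> ennreal" where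
  "wp SKIP f s = f s"
| "wp (NAssign x e v) f s = f (set_nmem x (nval e s) (nval v s) s)"
| "wp (RAssign x e v) f s = f (set_rmem x (nval e s) (rval v s) s)"
| "wp (Query x e i a) f s =
     f ((set_rmem x (nval e s) (answer n d (nval i s) (nval a s)) s)
         \<lparr>queries := (nval i s, nval a s) # queries s\<rparr>)"
| "wp (Toss x e p q) f s =
     (let r = rval p s / rval q s in
      if 0 \<le> r \<and> r \<le> 1
      then ennreal r * f (set_nmem x (nval e s) 1 s) + ennreal (1 - r) * f (set_nmem x (nval e s) 0 s)
      else \<top>)"
| "wp (Seq c1 c2) f s = wp c1 (wp c2 f) s"
| "wp (Cond b c1 c2) f s = (if bval n \<sigma> b s then wp c1 f s else wp c2 f s)"
| "wp (While b c) f s = \<top>"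

text \<open>The 0 for \<open>While\<close> is a dummy, sound because \<open>wp\<close> is
  \<open>\<top>\<close> there.\<close>

primrec ctime :: "com \<Rightarrow> nat" where
  "ctime SKIP = 0"
| "ctime (NAssign x e v) = 1"
| "ctime (RAssign x e v) = 1"
| "ctime (Query x e i a) = 1"
| "ctime (Toss x e p q) = 1"
| "ctime (Seq c1 c2) = Suc (ctime c1 + ctime c2)"
| "ctime (Cond b c1 c2) = Suc (max (ctime c1) (ctime c2))"
| "ctime (While b c) = 0"

lemma wpt_Cond: "wpt (Suc t) (Cond b c1 c2) f s = wpt t (if bval n \<sigma> b s then c1 else c2) f s"
  by (simp add: wpt_Suc nn_integral_return_pmf)

lemma wpt_While:
  "wpt (Suc t) (While b c) f s = wpt t (if bval n \<sigma> b s then Seq c (While b c) else SKIP) f s"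
  by (simp add: wpt_Suc nn_integral_return_pmf)

lemma wpt_le_wp: "wpt (ctime c) c f s \<le> wp c f s"
proof (induction c arbitrary: f s)
  case (Toss x e p q)
  show ?case
    by (auto simp: Let_def wpt_Suc mult.commute)
next
  case (Seq c1 c2)
  show ?case using wpt_SeqI[OF order_trans[OF wpt_mono[OF Seq.IH(2)] Seq.IH(1)] order_refl]
    by simp
next
  case (Cond b c1 c2)
  have "wpt (max (ctime c1) (ctime c2)) c1 f s \<le> wp c1 f s"
    by (rule order_trans[OF wpt_time_mono Cond.IH(1)]) simp
  moreover have "wpt (max (ctime c1) (ctime c2)) c2 f s \<le> wp c2 f s"
    by (rule order_trans[OF wpt_time_mono Cond.IH(2)]) simp
  ultimately show ?case by (simp add: wpt_Cond)
qed (simp_all add: wpt_Suc nn_integral_return_pmf)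

lemma wpt_wpI:
  assumes "wp c f s \<le> v" "ctime c \<le> t"
  shows "wpt t c f s \<le> v"
  using order_trans[OF wpt_time_mono[OF assms(2)] wpt_le_wp] assms(1) by (rule order_trans)

text \<open>\<open>g\<close> is a supermartingale along the loop: its expectation after the body,
  with the counter advanced, is at most its value before. \<open>I\<close> is an invariant that
  holds in every outcome, and the body has to leave the counter alone.\<close>

lemma wpt_For:
  fixes I :: "nat \<Rightarrow> state \<Rightarrow> bool" and g :: "nat \<Rightarrow> state \<Rightarrow> ennreal"
  assumes bound: "\<And>j s. I j s \<Longrightarrow> nval e s = N"
    and body: "\<And>j s. j < N \<Longrightarrow> I j s \<Longrightarrow> nmem s x 0 = j \<Longrightarrow>
      wpt tb c (\<lambda>s. if nmem s x 0 = j \<and> I (Suc j) (set_nmem x 0 (Suc j) s)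
        then g (Suc j) (set_nmem x 0 (Suc j) s) else \<top>) s \<le> g j s"
    and init: "I 0 (set_nmem x 0 0 s)" "g 0 (set_nmem x 0 0 s) \<le> v"
    and post: "\<And>s. I N s \<Longrightarrow> nmem s x 0 = N \<Longrightarrow> f s \<le> g N s"
  shows "wpt (N * (tb + 4) + 4) (For x e c) (\<lambda>s. if I N s \<and> nmem s x 0 = N then f s else \<top>) s \<le> v"
proof -
  let ?inc = "NAssign x (NConst 0) (NAdd (NVar x (NConst 0)) (NConst 1))"
  let ?W = "While (NLess (NVar x (NConst 0)) e) (Seq c ?inc)"
  let ?f = "\<lambda>s. if I N s \<and> nmem s x 0 = N then g N s else \<top>"
  have loop: "wpt (r * (tb + 4) + 1) ?W ?f s \<le> g j s"
    if "j + r = N" "I j s" "nmem s x 0 = j" for r j s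
    using that
  proof (induction r arbitrary: j s)
    case 0
    then show ?case using bound[of j s] by (simp add: wpt_While)
  next
    case (Suc r)
    then have "j < N" by simp
    let ?G = "\<lambda>s. if nmem s x 0 = j \<and> I (Suc j) (set_nmem x 0 (Suc j) s)
        then g (Suc j) (set_nmem x 0 (Suc j) s) else \<top>"
    have rest: "wpt (r * (tb + 4) + 1) ?W ?f (set_nmem x 0 (Suc j) s') \<le> ?G s'"
      if "nmem s' x 0 = j" for s'
      using Suc.IH[of "Suc j" "set_nmem x 0 (Suc j) s'"] Suc.prems that by auto
    have "wpt (Suc (Suc (tb + 1) + (r * (tb + 4) + 1))) (Seq (Seq c ?inc) ?W) ?f s \<le> g j s"
    proof (rule wpt_SeqI[OF wpt_SeqI order_refl])
      show "wpt tb c ?G s \<le> g j s"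
        using body[OF \<open>j < N\<close>] Suc.prems by simp
      show "wpt 1 ?inc (wpt (r * (tb + 4) + 1) ?W ?f) s' \<le> ?G s'" for s'
        using rest[of s'] by (cases "nmem s' x 0 = j") (auto simp: wpt_Suc wpt_0 nn_integral_return_pmf)
    qed
    \<comment> \<open>The 4 extra steps of an iteration are the test, the increment and two
      transitions that leave a finished first component of \<open>Seq\<close>.\<close>
    moreover have eq: "Suc r * (tb + 4) + 1 = Suc (Suc (Suc (tb + 1) + (r * (tb + 4) + 1)))"
      by simp
    moreover have b: "bval n \<sigma> (NLess (NVar x (NConst 0)) e) s"
      using bound[of j s] Suc.prems \<open>j < N\<close> by simp
    ultimately show ?case unfolding eq wpt_While by (simp only: b if_True)
  qed
  have "wpt (Suc (1 + (N * (tb + 4) + 1))) (For x e c) ?f s \<le> v"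
    unfolding For_def
  proof (rule wpt_SeqI)
    show "wpt 1 (NAssign x (NConst 0) (NConst 0)) (wpt (N * (tb + 4) + 1) ?W ?f) s \<le> v"
      using order_trans[OF loop init(2)] init(1) by (simp add: wpt_Suc wpt_0 nn_integral_return_pmf)
  qed (rule order_refl)
  moreover have "Suc (1 + (N * (tb + 4) + 1)) \<le> N * (tb + 4) + 4" by simp
  ultimately have "wpt (N * (tb + 4) + 4) (For x e c) ?f s \<le> v"
    using wpt_time_mono by (meson order_trans)
  then show ?thesis
    by (rule order_trans[rotated]) (rule wpt_mono, auto simp: post)
qed

text \<open>Every configuration in the support has positive probability, so one value
  \<open>\<top>\<close> would already make the integral infinite.\<close>

lemma wpt_finiteD:
  assumes "wpt t c f s < \<top>" "cs \<in> set_pmf (steps n \<sigma> d t (c, s))"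
  shows "fst cs = SKIP" "f (snd cs) < \<top>"
proof -
  have "AE cs in measure_pmf (steps n \<sigma> d t (c, s)). (if fst cs = SKIP then f (snd cs) else \<top>) \<noteq> \<infinity>"
    using assms(1) unfolding wpt_def by (intro nn_integral_PInf_AE) auto
  then have "(if fst cs = SKIP then f (snd cs) else \<top>) \<noteq> \<infinity>"
    using assms(2) by (simp add: AE_measure_pmf_iff)
  then have "fst cs = SKIP \<and> f (snd cs) \<noteq> \<top>" by (simp split: if_splits)
  then show "fst cs = SKIP" "f (snd cs) < \<top>" using top.not_eq_extremum by blast+
qed

text \<open>Total correctness within \<open>t\<close> steps in every outcome. With values 0 and
  \<open>\<top>\<close> it is an instance of \<open>wpt\<close>, so the rules above carry
  over.\<close>

definition triple :: "(state \<Rightarrow> bool) \<Rightarrow> nat \<Rightarrow> com \<Rightarrow> (state \<Rightarrow> bool) \<Rightarrow> bool" where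
  "triple P t c Q \<longleftrightarrow> (\<forall>s. P s \<longrightarrow> wpt t c (\<lambda>s. if Q s then 0 else \<top>) s \<le> 0)"

lemma triple_Seq:
  assumes "triple P t1 c1 Q" "triple Q t2 c2 R"
  shows "triple P (Suc (t1 + t2)) (Seq c1 c2) R"
  unfolding triple_def
proof (intro allI impI wpt_SeqI)
  fix s assume "P s"
  then show "wpt t1 c1 (\<lambda>s. if Q s then 0 else \<top>) s \<le> 0" using assms(1) by (simp add: triple_def)
next
  fix s
  show "wpt t2 c2 (\<lambda>s. if R s then 0 else \<top>) s \<le> (if Q s then 0 else \<top>)"
    using assms(2) by (auto simp: triple_def)
qed

lemma triple_weaken:
  assumes "triple P t c Q" "\<And>s. P' s \<Longrightarrow> P s" "\<And>s. Q s \<Longrightarrow> Q' s" "t \<le> t'"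
  shows "triple P' t' c Q'"
  unfolding triple_def
proof (intro allI impI)
  fix s assume "P' s"
  have "wpt t' c (\<lambda>s. if Q' s then 0 else \<top>) s \<le> wpt t c (\<lambda>s. if Q' s then 0 else \<top>) s"
    by (rule wpt_time_mono[OF assms(4)])
  also have "\<dots> \<le> wpt t c (\<lambda>s. if Q s then 0 else \<top>) s"
    using assms(3) by (intro wpt_mono) auto
  also have "\<dots> \<le> 0" using assms(1,2) \<open>P' s\<close> by (simp add: triple_def)
  finally show "wpt t' c (\<lambda>s. if Q' s then 0 else \<top>) s \<le> 0" .
qed

text \<open>Fixes the initial state, so that its memory contents can serve as constants in
  intermediate assertions.\<close>

lemma triple_all:
  assumes "\<And>s0. P s0 \<Longrightarrow> triple (\<lambda>s. s = s0) t c Q"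
  shows "triple P t c Q"
  using assms by (simp add: triple_def)

text \<open>That \<open>wp c F s = F s'\<close> for all \<open>F\<close> expresses that
  \<open>c\<close> leads deterministically from \<open>s\<close> to \<open>s'\<close>;
  simplification computes this \<open>s'\<close>.\<close>

lemma triple_wp:
  assumes "\<And>s. P s \<Longrightarrow> \<exists>s'. (\<forall>F. wp c F s = F s') \<and> Q s'" "ctime c \<le> t"
  shows "triple P t c Q"
  unfolding triple_def
proof (intro allI impI wpt_wpI)
  fix s assume "P s"
  then obtain s' where "\<forall>F. wp c F s = F s'" "Q s'" using assms(1) by blast
  then show "wp c (\<lambda>s. if Q s then 0 else \<top>) s \<le> 0" by simp
qed (rule assms(2))

lemma triple_For:
  assumes bound: "\<And>j s. I j s \<Longrightarrow> nval e s = N"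
    and counter: "\<And>j j' s. I j (set_nmem x 0 j' s) = I j s"
    and body: "\<And>j. j < N \<Longrightarrow>
      triple (\<lambda>s. I j s \<and> nmem s x 0 = j) tb c (\<lambda>s. I (Suc j) s \<and> nmem s x 0 = j)"
  shows "triple (I 0) (N * (tb + 4) + 4) (For x e c) (I N)"
  unfolding triple_def
proof (intro allI impI)
  fix s assume "I 0 s"
  have "wpt (N * (tb + 4) + 4) (For x e c) (\<lambda>s. if I N s \<and> nmem s x 0 = N then 0 else \<top>) s \<le> 0"
  proof (rule wpt_For[where I = I and g = "\<lambda>_ _. 0"])
    fix j s assume "j < N" "I j s" "nmem s x 0 = j"
    then show "wpt tb c (\<lambda>s. if nmem s x 0 = j \<and> I (Suc j) (set_nmem x 0 (Suc j) s) then 0 else \<top>) s \<le> 0"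
      using body[of j] by (simp add: triple_def counter conj_commute)
  qed (use \<open>I 0 s\<close> counter bound in auto)
  then show "wpt (N * (tb + 4) + 4) (For x e c) (\<lambda>s. if I N s then 0 else \<top>) s \<le> 0"
    by (rule order_trans[rotated]) (rule wpt_mono, simp)
qed

end

section \<open>Farthest-first traversal\<close>

text \<open>\<open>fav[i]\<close> is the favorite center of agent \<open>i\<close>, and \<open>far[a]\<close> the agent that center \<open>a\<close> ranks
  last among those whose favorite is \<open>a\<close>.  Initially both \<open>fav[i]\<close> and the first center \<open>c\<close> are 0.
  Only centers can have \<open>far[a] \<noteq> a\<close>, so that only centers are queried.\<close>

definition fav_body :: com where
  "fav_body =
     Seq (Cond (Prefers (nvar ''i'') (nvar ''c'') (NVar ''fav'' (nvar ''i'')))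
           (NAssign ''fav'' (nvar ''i'') (nvar ''c'')) SKIP)
         (NAssign ''far'' (nvar ''i'') (nvar ''i''))"

definition far_body :: com where
  "far_body =
     Cond (Prefers (NVar ''fav'' (nvar ''i'')) (NVar ''far'' (NVar ''fav'' (nvar ''i''))) (nvar ''i''))
       (NAssign ''far'' (NVar ''fav'' (nvar ''i'')) (nvar ''i'')) SKIP"

text \<open>The guard spells \<open>far[i] \<noteq> i\<close> in a language without equality.
  \<open>r\<close> is the largest answer so far and \<open>c\<close> the agent attaining it.\<close>

definition query_body :: com where
  "query_body =
     Cond (Neg (Conj (Neg (NLess (nvar ''i'') (NVar ''far'' (nvar ''i''))))
                     (Neg (NLess (NVar ''far'' (nvar ''i'')) (nvar ''i'')))))
       (Seq (Query ''q'' (NConst 0) (nvar ''i'') (NVar ''far'' (nvar ''i'')))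
            (Cond (RLess (rvar ''r'') (rvar ''q''))
               (Seq (RAssign ''r'' (NConst 0) (rvar ''q''))
                    (NAssign ''c'' (NConst 0) (NVar ''far'' (nvar ''i'')))) SKIP))
       SKIP"

definition farthest_round :: com where
  "farthest_round =
     Seq (For ''i'' (nvar ''n'') fav_body)
    (Seq (For ''i'' (nvar ''n'') far_body)
    (Seq (RAssign ''r'' (NConst 0) (RNat (NConst 0)))
         (For ''i'' (nvar ''n'') query_body)))"

text \<open>Without multiplication in the language, \<open>l * r\<close> is formed by adding
  \<open>r\<close> repeatedly.\<close>

definition farthest_first :: com where
  "farthest_first =
     Seq (For ''m'' (nvar ''k'') farthest_round)
         (For ''j'' (nvar ''l'') (RAssign ''out'' (NConst 0) (RAdd (rvar ''out'') (rvar ''r''))))"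

lemma coin_free_farthest_first: "coin_free farthest_first"
  by (simp add: farthest_first_def farthest_round_def fav_body_def far_body_def query_body_def For_def)

section \<open>Correctness and query count of farthest-first traversal\<close>

locale farthest_run = agents n d + machine n \<sigma> d
  for n :: nat and \<sigma> :: "nat \<Rightarrow> nat rel" and d :: "nat \<Rightarrow> nat \<Rightarrow> real" +
  fixes k l :: nat
  assumes k: "1 \<le> k" "k \<le> n" and l: "1 \<le> l" "l \<le> n"
    and cons: "consistent_profile {..<n} \<sigma> d"
begin

lemma pref_refl: "i < n \<Longrightarrow> a < n \<Longrightarrow> (a, a) \<in> \<sigma> i"
  and pref_self: "i < n \<Longrightarrow> a < n \<Longrightarrow> (i, a) \<in> \<sigma> i"
  and pref_total: "i < n \<Longrightarrow> a < n \<Longrightarrow> b < n \<Longrightarrow> (a, b) \<notin> \<sigma> i \<Longrightarrow> (b, a) \<in> \<sigma> i"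
  and pref_trans: "i < n \<Longrightarrow> (a, b) \<in> \<sigma> i \<Longrightarrow> (b, c) \<in> \<sigma> i \<Longrightarrow> (a, c) \<in> \<sigma> i"
  and pref_dist: "i < n \<Longrightarrow> (a, b) \<in> \<sigma> i \<Longrightarrow> d i a \<le> d i b"
proof -
  assume i: "i < n"
  then have lin: "linear_order_on {..<n} (\<sigma> i)" using cons by (simp add: consistent_profile_def)
  then have refl: "refl_on {..<n} (\<sigma> i)" and tr: "trans (\<sigma> i)" and tot: "total_on {..<n} (\<sigma> i)"
    by (auto simp: order_on_defs)
  show "(a, a) \<in> \<sigma> i" if "a < n" using refl that by (auto simp: refl_on_def)
  then show "(b, a) \<in> \<sigma> i" if "a < n" "b < n" "(a, b) \<notin> \<sigma> i"
    using tot that by (cases "a = b") (auto simp: total_on_def)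
  show "(i, a) \<in> \<sigma> i" if "a < n" using cons i that by (simp add: consistent_profile_def)
  show "(a, c) \<in> \<sigma> i" if "(a, b) \<in> \<sigma> i" "(b, c) \<in> \<sigma> i" using tr that by (rule transD)
  show "d i a \<le> d i b" if "(a, b) \<in> \<sigma> i" using cons i that by (simp add: consistent_profile_def)
qed

definition is_fav :: "nat set \<Rightarrow> nat \<Rightarrow> nat \<Rightarrow> bool" where
  "is_fav S i a \<longleftrightarrow> a \<in> S \<and> (\<forall>b\<in>S. (a, b) \<in> \<sigma> i)"

lemma is_fav_insert:
  assumes "is_fav S i a" "i < n" "a < n" "c < n"
  shows "is_fav (insert c S) i (if (c, a) \<in> \<sigma> i then c else a)"
proof (cases "(c, a) \<in> \<sigma> i")
  case True
  then have "(c, b) \<in> \<sigma> i" if "b \<in> S" for b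
    using assms(1) pref_trans[OF assms(2) True] that by (simp add: is_fav_def)
  then show ?thesis using True pref_refl[OF assms(2,4)] by (simp add: is_fav_def)
next
  case False
  then show ?thesis using assms(1) pref_total[OF assms(2,4,3)] by (simp add: is_fav_def)
qed

definition base :: "nat \<Rightarrow> state \<Rightarrow> bool" where
  "base m s \<longleftrightarrow> nmem s ''n'' 0 = n \<and> nmem s ''k'' 0 = k \<and> nmem s ''l'' 0 = l \<and>
     nmem s ''m'' 0 = m \<and> rmem s ''out'' 0 = 0"

text \<open>\<open>m\<close> counts rounds. Confining the queried agents to the centers
  \<open>S\<close> is what makes the total quadratic in \<open>k\<close>.\<close>

definition few_queries :: "nat \<Rightarrow> nat set \<Rightarrow> state \<Rightarrow> bool" where
  "few_queries m S s \<longleftrightarrow> (\<forall>i<n. qcount s i \<le> m \<and> (0 < qcount s i \<longrightarrow> i \<in> S))"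

lemma fav_loop:
  assumes a: "a < n" and S: "S \<subseteq> {..<n}"
  shows "triple
    (\<lambda>s. base m s \<and> nmem s ''c'' 0 = a \<and> few_queries m S s \<and> (\<forall>i<n. is_fav S i (nmem s ''fav'' i)))
    (n * 9 + 4) (For ''i'' (nvar ''n'') fav_body)
    (\<lambda>s. base m s \<and> nmem s ''c'' 0 = a \<and> few_queries m S s \<and>
      (\<forall>i<n. is_fav (insert a S) i (nmem s ''fav'' i)) \<and> (\<forall>i<n. nmem s ''far'' i = i))"
proof -
  define I where "I j s \<longleftrightarrow> base m s \<and> nmem s ''c'' 0 = a \<and> few_queries m S s \<and>
    (\<forall>i<n. is_fav (if i < j then insert a S else S) i (nmem s ''fav'' i)) \<and>
    (\<forall>i<j. nmem s ''far'' i = i)" for j s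
  have "triple (I 0) (n * (5 + 4) + 4) (For ''i'' (nvar ''n'') fav_body) (I n)"
  proof (rule triple_For)
    show "nval (nvar ''n'') s = n" if "I j s" for j s using that by (simp add: I_def base_def)
    show "I j (set_nmem ''i'' 0 j' s) = I j s" for j j' s
      by (simp add: I_def base_def few_queries_def)
    fix j assume j: "j < n"
    show "triple (\<lambda>s. I j s \<and> nmem s ''i'' 0 = j) 5 fav_body (\<lambda>s. I (Suc j) s \<and> nmem s ''i'' 0 = j)"
    proof (rule triple_wp)
      fix s assume s: "I j s \<and> nmem s ''i'' 0 = j"
      let ?f = "nmem s ''fav'' j"
      have f: "is_fav S j ?f" using s j by (auto simp: I_def)
      then have fn: "?f < n" using S by (auto simp: is_fav_def)
      have c: "nmem s ''c'' 0 = a" using s by (simp add: I_def)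
      let ?s = "set_nmem ''far'' j j (if (a, ?f) \<in> \<sigma> j then set_nmem ''fav'' j a s else s)"
      have "wp fav_body F s = F ?s" for F
        using s c j a fn by (cases "(a, ?f) \<in> \<sigma> j") (simp_all add: fav_body_def)
      moreover have "I (Suc j) ?s"
        using s is_fav_insert[OF f j fn a]
        by (cases "(a, ?f) \<in> \<sigma> j") (auto simp: I_def base_def few_queries_def less_Suc_eq)
      moreover have "nmem ?s ''i'' 0 = j" using s by simp
      ultimately show "\<exists>s'. (\<forall>F. wp fav_body F s = F s') \<and> I (Suc j) s' \<and> nmem s' ''i'' 0 = j"
        by blast
    qed (simp add: fav_body_def)
  qed
  then show ?thesis by (rule triple_weaken) (auto simp: I_def)
qed

lemma far_loop:
  assumes f: "\<And>i. i < n \<Longrightarrow> f i < n"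
  shows "triple
    (\<lambda>s. base m s \<and> nmem s ''c'' 0 = a \<and> few_queries m S s \<and> (\<forall>i<n. nmem s ''fav'' i = f i) \<and>
      (\<forall>i<n. nmem s ''far'' i = i))
    (n * 6 + 4) (For ''i'' (nvar ''n'') far_body)
    (\<lambda>s. base m s \<and> nmem s ''c'' 0 = a \<and> few_queries m S s \<and> (\<forall>i<n. nmem s ''fav'' i = f i) \<and>
      (\<forall>b<n. nmem s ''far'' b < n \<and> (nmem s ''far'' b \<noteq> b \<longrightarrow> f (nmem s ''far'' b) = b)) \<and>
      (\<forall>i<n. (i, nmem s ''far'' (f i)) \<in> \<sigma> (f i)))"
proof -
  define I where "I j s \<longleftrightarrow> base m s \<and> nmem s ''c'' 0 = a \<and> few_queries m S s \<and>
    (\<forall>i<n. nmem s ''fav'' i = f i) \<and>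
    (\<forall>b<n. nmem s ''far'' b < n \<and> (nmem s ''far'' b \<noteq> b \<longrightarrow> f (nmem s ''far'' b) = b)) \<and>
    (\<forall>i<j. (i, nmem s ''far'' (f i)) \<in> \<sigma> (f i))" for j s
  have "triple (I 0) (n * (2 + 4) + 4) (For ''i'' (nvar ''n'') far_body) (I n)"
  proof (rule triple_For)
    show "nval (nvar ''n'') s = n" if "I j s" for j s using that by (simp add: I_def base_def)
    show "I j (set_nmem ''i'' 0 j' s) = I j s" for j j' s
      by (simp add: I_def base_def few_queries_def)
    fix j assume j: "j < n"
    show "triple (\<lambda>s. I j s \<and> nmem s ''i'' 0 = j) 2 far_body (\<lambda>s. I (Suc j) s \<and> nmem s ''i'' 0 = j)"
    proof (rule triple_wp)
      fix s assume s: "I j s \<and> nmem s ''i'' 0 = j"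
      let ?g = "nmem s ''far''"
      have g: "?g (f j) < n" using s f[OF j] by (auto simp: I_def)
      have fj: "nmem s ''fav'' j = f j" using s j by (simp add: I_def)
      let ?b = "(?g (f j), j) \<in> \<sigma> (f j)"
      let ?s = "if ?b then set_nmem ''far'' (f j) j s else s"
      have "wp far_body F s = F ?s" for F
        using s fj j g f[OF j] by (cases ?b) (simp_all add: far_body_def)
      moreover have "I (Suc j) ?s"
      proof (cases ?b)
        case True
        \<comment> \<open>Agents of this cluster met before \<open>j\<close> rank at least as high
          as the old entry of \<open>far\<close>, which ranks at least as high as
          \<open>j\<close>.\<close>
        have "(i, j) \<in> \<sigma> (f j)" if "i \<le> j" "f i = f j" for i
        proof (cases "i = j")
          case True
          then show ?thesis using pref_refl f[OF j] j by simp
        next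
          case False
          then have "(i, ?g (f i)) \<in> \<sigma> (f i)" using s that(1) by (simp add: I_def)
          then show ?thesis using that(2) True pref_trans[OF f[OF j]] by metis
        qed
        then show ?thesis using s j True by (auto simp: I_def base_def few_queries_def less_Suc_eq)
      next
        case False
        then have "(j, ?g (f j)) \<in> \<sigma> (f j)" using pref_total f[OF j] g j by blast
        then show ?thesis using s False by (auto simp: I_def less_Suc_eq)
      qed
      moreover have "nmem ?s ''i'' 0 = j" using s by simp
      ultimately show "\<exists>s'. (\<forall>F. wp far_body F s = F s') \<and> I (Suc j) s' \<and> nmem s' ''i'' 0 = j"
        by blast
    qed (simp add: far_body_def)
  qed
  then show ?thesis by (rule triple_weaken) (use f pref_self in \<open>auto simp: I_def\<close>)
qed

text \<open>The final disjunction covers the case that no answer is positive: then \<open>c\<close>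
  keeps its old value and \<open>r = 0\<close>. Repeating a center is harmless there, since
  separation by 0 is trivial.\<close>

lemma query_loop:
  assumes g: "\<And>b. b < n \<Longrightarrow> g b < n" and f: "\<And>b. b < n \<Longrightarrow> g b \<noteq> b \<Longrightarrow> f (g b) = b"
    and S: "\<And>b. b < n \<Longrightarrow> g b \<noteq> b \<Longrightarrow> b \<in> S'" "S \<subseteq> S'"
  shows "triple
    (\<lambda>s. base m s \<and> nmem s ''c'' 0 = a \<and> few_queries m S s \<and> (\<forall>b<n. nmem s ''far'' b = g b) \<and>
      (\<forall>i<n. nmem s ''fav'' i = f i) \<and> rmem s ''r'' 0 = 0)
    (n * 11 + 4) (For ''i'' (nvar ''n'') query_body)
    (\<lambda>s. base m s \<and> few_queries (Suc m) S' s \<and> (\<forall>i<n. nmem s ''fav'' i = f i) \<and>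
      0 \<le> rmem s ''r'' 0 \<and> (\<forall>b<n. d b (g b) \<le> rmem s ''r'' 0) \<and>
      (nmem s ''c'' 0 = a \<and> rmem s ''r'' 0 = 0 \<or>
       (let c = nmem s ''c'' 0 in c < n \<and> f c < n \<and> rmem s ''r'' 0 = d (f c) c)))"
proof -
  define I where "I j s \<longleftrightarrow> base m s \<and> (\<forall>b<n. nmem s ''far'' b = g b) \<and> (\<forall>i<n. nmem s ''fav'' i = f i) \<and>
    (\<forall>i<n. qcount s i \<le> m + of_bool (i < j) \<and> (0 < qcount s i \<longrightarrow> i \<in> S')) \<and>
    0 \<le> rmem s ''r'' 0 \<and> (\<forall>b<j. d b (g b) \<le> rmem s ''r'' 0) \<and>
    (nmem s ''c'' 0 = a \<and> rmem s ''r'' 0 = 0 \<or>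
       (let c = nmem s ''c'' 0 in c < n \<and> f c < n \<and> rmem s ''r'' 0 = d (f c) c))" for j s
  have "triple (I 0) (n * (7 + 4) + 4) (For ''i'' (nvar ''n'') query_body) (I n)"
  proof (rule triple_For)
    show "nval (nvar ''n'') s = n" if "I j s" for j s using that by (simp add: I_def base_def)
    show "I j (set_nmem ''i'' 0 j' s) = I j s" for j j' s
      by (simp add: I_def base_def)
    fix j assume j: "j < n"
    show "triple (\<lambda>s. I j s \<and> nmem s ''i'' 0 = j) 7 query_body (\<lambda>s. I (Suc j) s \<and> nmem s ''i'' 0 = j)"
    proof (rule triple_wp)
      fix s assume s: "I j s \<and> nmem s ''i'' 0 = j"
      have gj: "nmem s ''far'' j = g j" using s j by (simp add: I_def)
      let ?q = "(set_rmem ''q'' 0 (d j (g j)) s)\<lparr>queries := (j, g j) # queries s\<rparr>"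
      let ?b = "rmem s ''r'' 0 < d j (g j)"
      let ?s = "if g j = j then s else if ?b then set_nmem ''c'' 0 (g j) (set_rmem ''r'' 0 (d j (g j)) ?q) else ?q"
      have "wp query_body F s = F ?s" for F
        using s gj j g[OF j]
        by (cases "g j = j"; cases ?b) (simp_all add: query_body_def answer_def linorder_neq_iff)
      moreover have "I (Suc j) ?s"
      proof (cases "g j = j")
        case True
        \<comment> \<open>An agent that is its own \<open>far\<close> entry is at distance 0 from
          it, so skipping the query loses nothing.\<close>
        then show ?thesis using s j dist_self[OF j] by (auto simp: I_def less_Suc_eq)
      next
        case False
        then have *: "j \<in> S'" "f (g j) = j" using S(1) f j by auto
        have **: "0 \<le> d j (g j)" using dist_nonneg g j by simp
        show ?thesis
        proof (cases ?b)
          case True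
          then show ?thesis using s False * ** g[OF j] j
            by (auto simp: I_def base_def less_Suc_eq Let_def)
        next
          case b: False
          then show ?thesis using s False * j
            by (auto simp: I_def base_def less_Suc_eq Let_def)
        qed
      qed
      moreover have "nmem ?s ''i'' 0 = j" using s by simp
      ultimately show "\<exists>s'. (\<forall>F. wp query_body F s = F s') \<and> I (Suc j) s' \<and> nmem s' ''i'' 0 = j"
        by blast
    qed (simp add: query_body_def)
  qed
  then show ?thesis by (rule triple_weaken) (use S(2) in \<open>auto simp: I_def few_queries_def le_Suc_eq\<close>)
qed

text \<open>After \<open>m\<close> rounds \<open>c 0\<close>, ..., \<open>c (m - 1)\<close> are the
  centers and \<open>c m\<close> is the pending one; thus \<open>k\<close> rounds provide the
  \<open>k + 1\<close> separated points. The \<open>max 1 m\<close> reflects that \<open>fav\<close>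
  is 0, the first center, before any round.\<close>

definition Inv :: "nat \<Rightarrow> state \<Rightarrow> bool" where
  "Inv m s \<longleftrightarrow> base (nmem s ''m'' 0) s \<and>
     (\<exists>c. (\<forall>j\<le>m. c j < n) \<and> nmem s ''c'' 0 = c m \<and>
        (\<forall>i<n. is_fav (c ` {..<max 1 m}) i (nmem s ''fav'' i)) \<and>
        few_queries m (c ` {..<m}) s \<and>
        (0 < m \<longrightarrow> 0 \<le> rmem s ''r'' 0 \<and> (\<forall>i<n. \<exists>j<m. d i (c j) \<le> rmem s ''r'' 0) \<and>
           (\<forall>i j. i < j \<longrightarrow> j \<le> m \<longrightarrow> rmem s ''r'' 0 \<le> d (c i) (c j))))"

lemma farthest_round:
  "triple (\<lambda>s. Inv m s \<and> nmem s ''m'' 0 = m) (n * 26 + 16) farthest_round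
     (\<lambda>s. Inv (Suc m) s \<and> nmem s ''m'' 0 = m)"
proof (rule triple_all)
  fix s0 assume s0: "Inv m s0 \<and> nmem s0 ''m'' 0 = m"
  then obtain c where "(\<forall>j\<le>m. c j < n) \<and> nmem s0 ''c'' 0 = c m \<and>
        (\<forall>i<n. is_fav (c ` {..<max 1 m}) i (nmem s0 ''fav'' i)) \<and>
        few_queries m (c ` {..<m}) s0 \<and>
        (0 < m \<longrightarrow> 0 \<le> rmem s0 ''r'' 0 \<and> (\<forall>i<n. \<exists>j<m. d i (c j) \<le> rmem s0 ''r'' 0) \<and>
           (\<forall>i j. i < j \<longrightarrow> j \<le> m \<longrightarrow> rmem s0 ''r'' 0 \<le> d (c i) (c j)))"
    unfolding Inv_def by blast
  then have c: "\<And>j. j \<le> m \<Longrightarrow> c j < n" "nmem s0 ''c'' 0 = c m"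
    "\<And>i. i < n \<Longrightarrow> is_fav (c ` {..<max 1 m}) i (nmem s0 ''fav'' i)"
    "few_queries m (c ` {..<m}) s0"
    and r: "\<And>i. 0 < m \<Longrightarrow> i < n \<Longrightarrow> \<exists>j<m. d i (c j) \<le> rmem s0 ''r'' 0"
      "\<And>i j. 0 < m \<Longrightarrow> i < j \<Longrightarrow> j \<le> m \<Longrightarrow> rmem s0 ''r'' 0 \<le> d (c i) (c j)"
    by blast+
  let ?S = "c ` {..<max 1 m}" and ?S' = "c ` {..m}"
  let ?Q = "\<lambda>s. Inv (Suc m) s \<and> nmem s ''m'' 0 = m"
  have "insert m {..<max 1 m} = {..m}" by auto
  then have ins: "insert (c m) ?S = ?S'" by (metis image_insert)
  have b0: "base m s0" using s0 by (auto simp: Inv_def)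
  have few: "few_queries m ?S s0" using c(4) by (fastforce simp: few_queries_def)
  let ?P1 = "\<lambda>s. base m s \<and> nmem s ''c'' 0 = c m \<and> few_queries m ?S s \<and>
      (\<forall>i<n. is_fav ?S' i (nmem s ''fav'' i)) \<and> (\<forall>i<n. nmem s ''far'' i = i)"
  have P1: "triple (\<lambda>s. s = s0) (n * 9 + 4) (For ''i'' (nvar ''n'') fav_body) ?P1"
  proof (rule triple_weaken[OF fav_loop[of "c m" ?S m, unfolded ins]])
    show "base m s \<and> nmem s ''c'' 0 = c m \<and> few_queries m ?S s \<and> (\<forall>i<n. is_fav ?S i (nmem s ''fav'' i))"
      if "s = s0" for s
      using that b0 c(2,3) few by simp
  qed (use c(1) in auto)
  have "triple ?P1 (Suc ((n * 6 + 4) + Suc (1 + (n * 11 + 4))))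
    (Seq (For ''i'' (nvar ''n'') far_body)
      (Seq (RAssign ''r'' (NConst 0) (RNat (NConst 0))) (For ''i'' (nvar ''n'') query_body))) ?Q"
  proof (rule triple_all)
    fix s1 assume s1: "?P1 s1"
    define f where "f i = nmem s1 ''fav'' i" for i
    have f: "is_fav ?S' i (f i)" if "i < n" for i using s1 that by (simp add: f_def)
    have fn: "f i < n" if "i < n" for i
    proof -
      have "f i \<in> ?S'" using f[OF that] by (simp add: is_fav_def)
      then show ?thesis using c(1) by auto
    qed
    let ?P2 = "\<lambda>s. base m s \<and> nmem s ''c'' 0 = c m \<and> few_queries m ?S s \<and> (\<forall>i<n. nmem s ''fav'' i = f i) \<and>
      (\<forall>b<n. nmem s ''far'' b < n \<and> (nmem s ''far'' b \<noteq> b \<longrightarrow> f (nmem s ''far'' b) = b)) \<and>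
      (\<forall>i<n. (i, nmem s ''far'' (f i)) \<in> \<sigma> (f i))"
    let ?P3 = "\<lambda>s. ?P2 s \<and> rmem s ''r'' 0 = 0"
    have P2: "triple (\<lambda>s. s = s1) (n * 6 + 4) (For ''i'' (nvar ''n'') far_body) ?P2"
      by (rule triple_weaken[OF far_loop[of f m "c m" ?S]]) (use s1 fn in \<open>auto simp: f_def\<close>)
    have P3: "triple ?P2 1 (RAssign ''r'' (NConst 0) (RNat (NConst 0))) ?P3"
    proof (rule triple_wp)
      fix s assume "?P2 s"
      then show "\<exists>s'. (\<forall>F. wp (RAssign ''r'' (NConst 0) (RNat (NConst 0))) F s = F s') \<and> ?P3 s'"
        by (intro exI[of _ "set_rmem ''r'' 0 0 s"]) (simp add: base_def few_queries_def)
    qed simp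
    have "triple ?P3 (n * 11 + 4) (For ''i'' (nvar ''n'') query_body) ?Q"
    proof (rule triple_all)
      fix s2 assume s2: "?P3 s2"
      define g where "g b = nmem s2 ''far'' b" for b
      have g: "g b < n" "g b \<noteq> b \<Longrightarrow> f (g b) = b" if "b < n" for b using s2 that by (auto simp: g_def)
      have fg: "(i, g (f i)) \<in> \<sigma> (f i)" if "i < n" for i using s2 that by (auto simp: g_def)
      have gS: "b \<in> ?S'" if "b < n" "g b \<noteq> b" for b
        using f[OF g(1)[OF that(1)]] g(2)[OF that] by (simp add: is_fav_def)
      have SS: "?S \<subseteq> ?S'" unfolding ins[symmetric] by blast
      show "triple (\<lambda>s. s = s2) (n * 11 + 4) (For ''i'' (nvar ''n'') query_body) ?Q"
      proof (rule triple_weaken[OF query_loop[OF g gS SS]])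
        fix s :: state
        let ?c = "nmem s ''c'' 0" and ?r = "rmem s ''r'' 0"
        assume s: "base m s \<and> few_queries (Suc m) ?S' s \<and> (\<forall>i<n. nmem s ''fav'' i = f i) \<and>
          0 \<le> ?r \<and> (\<forall>b<n. d b (g b) \<le> ?r) \<and>
          (?c = c m \<and> ?r = 0 \<or> (let c = ?c in c < n \<and> f c < n \<and> ?r = d (f c) c))"
        define c' where "c' = c(Suc m := ?c)"
        have cn: "?c < n" using s c(1)[of m] by (auto simp: Let_def)
        have S': "c' ` {..m} = ?S'" by (simp add: c'_def)
        have r_cases: "?r = 0 \<or> ?r = d ?c (f ?c)" using s dist_sym fn by (auto simp: Let_def)
        \<comment> \<open>\<open>r\<close> is 0 or the distance from the new point to its favorite
          center, hence at most its distance to any center.\<close>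
        have near: "?r \<le> d ?c (c i)" if "i \<le> m" for i
        proof -
          have "(f ?c, c i) \<in> \<sigma> ?c" using f[OF cn] that by (auto simp: is_fav_def)
          then show ?thesis using r_cases pref_dist[OF cn] dist_nonneg[OF cn c(1)[OF that]] by auto
        qed
        \<comment> \<open>By symmetry the ranking of the favorite \<open>f i\<close> bounds the
          distance of \<open>i\<close> by that of \<open>g (f i)\<close>, which \<open>r\<close>
          dominates.\<close>
        have cover: "\<exists>j<Suc m. d i (c' j) \<le> ?r" if i: "i < n" for i
        proof -
          obtain j where j: "j \<le> m" "f i = c j" using f[OF i] by (auto simp: is_fav_def)
          have "d i (f i) = d (f i) i" using dist_sym fn that by simp
          also have "\<dots> \<le> d (f i) (g (f i))" using pref_dist[OF fn fg] that by simp
          also have "\<dots> \<le> ?r" using s fn that by simp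
          finally show ?thesis using j by (intro exI[of _ j]) (auto simp: c'_def)
        qed
        \<comment> \<open>For old pairs the radius must not have grown: the new point was within the
          old radius of some earlier center.\<close>
        have sep: "?r \<le> d (c' i) (c' j)" if "i < j" "j \<le> Suc m" for i j
        proof (cases "j = Suc m")
          case True
          then show ?thesis using that near[of i] dist_sym[OF cn c(1)[of i]] by (simp add: c'_def)
        next
          case False
          then have "0 < m" using that by simp
          then obtain h where "h < m" "d ?c (c h) \<le> rmem s0 ''r'' 0" using r(1) cn by blast
          then have "?r \<le> rmem s0 ''r'' 0" using near[of h] by simp
          also have "\<dots> \<le> d (c i) (c j)" using r(2) \<open>0 < m\<close> that False by simp
          finally show ?thesis using that False by (simp add: c'_def)
        qed
        have "base (nmem s ''m'' 0) s" using s by (simp add: base_def)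
        moreover have "\<forall>j\<le>Suc m. c' j < n" "?c = c' (Suc m)"
          using c(1) cn by (simp_all add: c'_def le_Suc_eq)
        moreover have "c' ` {..<max 1 (Suc m)} = ?S'" "c' ` {..<Suc m} = ?S'"
          by (simp_all add: S' lessThan_Suc_atMost)
        moreover have "\<forall>i<n. is_fav ?S' i (nmem s ''fav'' i)" "few_queries (Suc m) ?S' s" "0 \<le> ?r"
          using s f by simp_all
        ultimately have "Inv (Suc m) s"
          unfolding Inv_def using cover sep by (intro conjI exI[of _ c'] impI allI) simp_all
        then show "?Q s" using s by (simp add: base_def)
      qed (use s2 in \<open>auto simp: g_def\<close>)
    qed
    then show "triple (\<lambda>s. s = s1) (Suc ((n * 6 + 4) + Suc (1 + (n * 11 + 4))))
      (Seq (For ''i'' (nvar ''n'') far_body)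
        (Seq (RAssign ''r'' (NConst 0) (RNat (NConst 0))) (For ''i'' (nvar ''n'') query_body))) ?Q"
      using triple_Seq[OF P2 triple_Seq[OF P3]] by blast
  qed
  from triple_Seq[OF P1 this]
  have "triple (\<lambda>s. s = s0) (Suc ((n * 9 + 4) + Suc ((n * 6 + 4) + Suc (1 + (n * 11 + 4))))) farthest_round ?Q"
    unfolding farthest_round_def .
  then show "triple (\<lambda>s. s = s0) (n * 26 + 16) farthest_round ?Q"
    by (rule triple_weaken) auto
qed

definition good :: "state \<Rightarrow> bool" where
  "good s \<longleftrightarrow> OPT {..<n} d k l \<le> real l * rmem s ''r'' 0 \<and> rmem s ''r'' 0 \<le> 2 * OPT {..<n} d k l \<and>
     (\<forall>i<n. qcount s i \<le> k) \<and> (\<Sum>i<n. qcount s i) \<le> k\<^sup>2"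

text \<open>The first \<open>k\<close> points cover all agents within \<open>r\<close>, and with the
  pending point there are \<open>k + 1\<close> points separated by \<open>r\<close>. At most
  \<open>k\<close> agents are queried, each at most \<open>k\<close> times.\<close>

lemma Inv_good:
  assumes "Inv k s"
  shows "good s"
proof -
  let ?r = "rmem s ''r'' 0"
  obtain c where "(\<forall>j\<le>k. c j < n) \<and> nmem s ''c'' 0 = c k \<and>
        (\<forall>i<n. is_fav (c ` {..<max 1 k}) i (nmem s ''fav'' i)) \<and>
        few_queries k (c ` {..<k}) s \<and>
        (0 < k \<longrightarrow> 0 \<le> ?r \<and> (\<forall>i<n. \<exists>j<k. d i (c j) \<le> ?r) \<and>
           (\<forall>i j. i < j \<longrightarrow> j \<le> k \<longrightarrow> ?r \<le> d (c i) (c j)))"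
    using assms unfolding Inv_def by blast
  then have c: "\<And>j. j \<le> k \<Longrightarrow> c j < n" "few_queries k (c ` {..<k}) s" "0 \<le> ?r"
    "\<And>i. i < n \<Longrightarrow> \<exists>j<k. d i (c j) \<le> ?r" "\<And>i j. i < j \<Longrightarrow> j \<le> k \<Longrightarrow> ?r \<le> d (c i) (c j)"
    using k(1) by auto
  let ?S = "c ` {..<k}"
  have cS: "card ?S \<le> k" using card_image_le[of "{..<k}" c] by simp
  have "0 < card ?S" using k by (simp add: card_gt_0_iff lessThan_empty_iff)
  then have S: "?S \<in> solutions n k" using cS c(1) by (auto simp: solutions_def)
  have "OPT {..<n} d k l \<le> real l * ?r"
    using c(4) by (intro OPT_le_radius[OF S c(3)]) auto
  moreover have "?r \<le> 2 * OPT {..<n} d k l"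
    using c by (intro separation_le_OPT[OF k l(1)]) auto
  moreover have "(\<Sum>i<n. qcount s i) \<le> k\<^sup>2"
  proof -
    have "(\<Sum>i<n. qcount s i) = (\<Sum>i\<in>?S. qcount s i)"
      using c(1,2) by (intro sum.mono_neutral_right) (auto simp: few_queries_def)
    also have "\<dots> \<le> (\<Sum>i\<in>?S. k)" using c(1,2) by (intro sum_mono) (auto simp: few_queries_def)
    also have "\<dots> \<le> k\<^sup>2" using cS by (simp add: power2_eq_square)
    finally show ?thesis .
  qed
  ultimately show ?thesis using c(2) by (simp add: good_def few_queries_def)
qed

lemma farthest_first_triple:
  "triple (\<lambda>s. s = init_state n k l) (9 + 25 * n + 26 * n\<^sup>2) farthest_first
     (\<lambda>s. good s \<and> rmem s ''out'' 0 = real l * rmem s ''r'' 0)"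
proof -
  define J where "J j s \<longleftrightarrow> nmem s ''l'' 0 = l \<and> good s \<and> rmem s ''out'' 0 = real j * rmem s ''r'' 0" for j s
  have "triple (Inv 0) (k * (n * 26 + 16 + 4) + 4) (For ''m'' (nvar ''k'') farthest_round) (Inv k)"
  proof (rule triple_For)
    show "nval (nvar ''k'') s = k" if "Inv j s" for j s using that by (simp add: Inv_def base_def)
    show "Inv j (set_nmem ''m'' 0 j' s) = Inv j s" for j j' s
      by (simp add: Inv_def base_def few_queries_def)
  qed (rule farthest_round)
  moreover have "triple (Inv k) (l * (1 + 4) + 4)
    (For ''j'' (nvar ''l'') (RAssign ''out'' (NConst 0) (RAdd (rvar ''out'') (rvar ''r'')))) (J l)"
  proof (rule triple_weaken[OF triple_For])
    show "nval (nvar ''l'') s = l" if "J j s" for j s using that by (simp add: J_def)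
    show "J j (set_nmem ''j'' 0 j' s) = J j s" for j j' s
      by (simp add: J_def good_def)
    show "J 0 s" if "Inv k s" for s
      using Inv_good[OF that] that by (simp add: J_def Inv_def base_def)
    show "triple (\<lambda>s. J j s \<and> nmem s ''j'' 0 = j) 1
      (RAssign ''out'' (NConst 0) (RAdd (rvar ''out'') (rvar ''r''))) (\<lambda>s. J (Suc j) s \<and> nmem s ''j'' 0 = j)" for j
    proof (rule triple_wp)
      fix s assume s: "J j s \<and> nmem s ''j'' 0 = j"
      show "\<exists>s'. (\<forall>F. wp (RAssign ''out'' (NConst 0) (RAdd (rvar ''out'') (rvar ''r''))) F s = F s') \<and>
        J (Suc j) s' \<and> nmem s' ''j'' 0 = j"
        using s by (intro exI[of _ "set_rmem ''out'' 0 (rmem s ''out'' 0 + rmem s ''r'' 0) s"])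
          (auto simp: J_def good_def algebra_simps)
    qed simp
  qed auto
  ultimately have "triple (Inv 0) (Suc ((k * (n * 26 + 16 + 4) + 4) + (l * (1 + 4) + 4))) farthest_first (J l)"
    unfolding farthest_first_def by (rule triple_Seq)
  then show ?thesis
  proof (rule triple_weaken)
    show "Inv 0 s" if "s = init_state n k l" for s
      unfolding Inv_def that using k
      by (intro conjI exI[of _ "\<lambda>_. 0"])
        (auto simp: base_def init_state_def is_fav_def few_queries_def qcount_def pref_refl)
    have "k * (n * 26 + 20) \<le> n * (n * 26 + 20)" using k by simp
    then show "Suc ((k * (n * 26 + 16 + 4) + 4) + (l * (1 + 4) + 4)) \<le> 9 + 25 * n + 26 * n\<^sup>2"
      using l by (simp add: power2_eq_square algebra_simps)
  qed (simp add: J_def)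
qed

lemma farthest_first_correct:
  assumes "cs \<in> set_pmf (steps n \<sigma> d (9 + 25 * n + 26 * n\<^sup>2) (farthest_first, init_state n k l))"
  shows "fst cs = SKIP \<and> good (snd cs) \<and> rmem (snd cs) ''out'' 0 = real l * rmem (snd cs) ''r'' 0"
proof -
  let ?Q = "\<lambda>s. good s \<and> rmem s ''out'' 0 = real l * rmem s ''r'' 0"
  have "wpt (9 + 25 * n + 26 * n\<^sup>2) farthest_first (\<lambda>s. if ?Q s then 0 else \<top>) (init_state n k l) < \<top>"
    using farthest_first_triple by (auto simp: triple_def intro: le_less_trans)
  from wpt_finiteD[OF this assms] show ?thesis by (auto split: if_splits)
qed

end

section \<open>The sampling mechanism\<close>

text \<open>Weighted reservoir sampling: agent \<open>i\<close> replaces the current candidate \<open>c\<close> with probability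
  \<open>w[i]\<close> over the sum of the weights up to \<open>i\<close>.\<close>

definition sample_body :: com where
  "sample_body =
     Seq (RAssign ''R'' (NConst 0) (RAdd (rvar ''R'') (RVar ''w'' (nvar ''i''))))
    (Seq (Toss ''t'' (NConst 0) (RVar ''w'' (nvar ''i'')) (rvar ''R''))
         (Cond (NLess (NConst 0) (nvar ''t'')) (NAssign ''c'' (NConst 0) (nvar ''i'')) SKIP))"

text \<open>The guard means \<open>m = 0 \<or> q < w[i]\<close>: round 0 overwrites, later rounds
  take the minimum. Every agent is asked once per round.\<close>

definition update_body :: com where
  "update_body =
     Seq (Query ''q'' (NConst 0) (nvar ''i'') (nvar ''c''))
    (Seq (Cond (Neg (Conj (NLess (NConst 0) (nvar ''m'')) (Neg (RLess (rvar ''q'') (RVar ''w'' (nvar ''i''))))))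
           (RAssign ''w'' (nvar ''i'') (rvar ''q'')) SKIP)
         (RAssign ''out'' (NConst 0) (RAdd (rvar ''out'') (RVar ''w'' (nvar ''i'')))))"

definition sampling_round :: com where
  "sampling_round =
     Seq (RAssign ''R'' (NConst 0) (RNat (NConst 0)))
    (Seq (For ''i'' (nvar ''n'') sample_body)
    (Seq (RAssign ''out'' (NConst 0) (RNat (NConst 0)))
         (For ''i'' (nvar ''n'') update_body)))"

text \<open>Unit weights make the first sample uniform; in round 0 they are overwritten.\<close>

definition sampling :: com where
  "sampling =
     Seq (For ''i'' (nvar ''n'') (RAssign ''w'' (nvar ''i'') (RNat (NConst 1))))
         (For ''m'' (nvar ''k'') sampling_round)"

section \<open>Expected estimate of the sampling mechanism\<close>

locale sampling_run = agents n d + machine n \<sigma> d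
  for n :: nat and \<sigma> :: "nat \<Rightarrow> nat rel" and d :: "nat \<Rightarrow> nat \<Rightarrow> real" +
  fixes k :: nat
  assumes k: "1 \<le> k" "k \<le> n"
begin

definition base :: "state \<Rightarrow> bool" where
  "base s \<longleftrightarrow> nmem s ''n'' 0 = n \<and> nmem s ''k'' 0 = k \<and> nmem s ''c'' 0 < n"

definition Inv :: "nat \<Rightarrow> state \<Rightarrow> bool" where
  "Inv m s \<longleftrightarrow> base s \<and> (m = 0 \<longrightarrow> (\<forall>i<n. rmem s ''w'' i = 1)) \<and>
     (0 < m \<longrightarrow> (\<exists>S\<in>solutions n m. \<forall>i<n. rmem s ''w'' i = set_dist d i S) \<and>
        rmem s ''out'' 0 = (\<Sum>i<n. rmem s ''w'' i)) \<and>
     (\<forall>i<n. qcount s i \<le> m)"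

text \<open>The expected final sum when \<open>m\<close> rounds are done: \<open>k - m\<close>
  samples remain, and at \<open>m = 0\<close> the first center is still to be drawn
  uniformly.\<close>

definition val :: "nat \<Rightarrow> (nat \<Rightarrow> real) \<Rightarrow> real" where
  "val m w = (if m = 0 then (\<Sum>a<n. dsample_cost (k - 1) (\<lambda>i. d i a)) / real n
     else dsample_cost (k - m) w)"

definition upd :: "nat \<Rightarrow> (nat \<Rightarrow> real) \<Rightarrow> nat \<Rightarrow> nat \<Rightarrow> real" where
  "upd m w a i = (if m = 0 then d i a else min (w i) (d i a))"

lemma val_cong: "(\<And>i. i < n \<Longrightarrow> w i = w' i) \<Longrightarrow> val m w = val m w'"
  unfolding val_def by (simp, intro impI dsample_cost_cong)

lemma update_loop:
  assumes s: "base s" "nmem s ''m'' 0 = m" "nmem s ''c'' 0 = a" "\<forall>i<n. rmem s ''w'' i = w i"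
    "rmem s ''out'' 0 = 0" "\<forall>i<n. qcount s i \<le> m"
  shows "wpt (n * 10 + 4) (For ''i'' (nvar ''n'') update_body)
    (\<lambda>s. if base s \<and> nmem s ''m'' 0 = m \<and> (\<forall>i<n. rmem s ''w'' i = upd m w a i) \<and>
        rmem s ''out'' 0 = (\<Sum>i<n. upd m w a i) \<and> (\<forall>i<n. qcount s i \<le> Suc m)
      then v else \<top>) s \<le> v"
proof -
  have an: "a < n" using s by (auto simp: base_def)
  define I where "I j s \<longleftrightarrow> base s \<and> nmem s ''m'' 0 = m \<and> nmem s ''c'' 0 = a \<and>
    (\<forall>i<n. rmem s ''w'' i = (if i < j then upd m w a i else w i)) \<and>
    rmem s ''out'' 0 = (\<Sum>i<j. upd m w a i) \<and> (\<forall>i<n. qcount s i \<le> m + of_bool (i < j))" for j s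
  have "wpt (n * (6 + 4) + 4) (For ''i'' (nvar ''n'') update_body)
    (\<lambda>s. if I n s \<and> nmem s ''i'' 0 = n then v else \<top>) s \<le> v"
  proof (rule wpt_For[where I = I and g = "\<lambda>_ _. v"])
    show "nval (nvar ''n'') s = n" if "I j s" for j s using that by (simp add: I_def base_def)
    show "I 0 (set_nmem ''i'' 0 0 s)" using s by (simp add: I_def base_def)
    fix j s assume j: "j < n" "I j s" "nmem s ''i'' 0 = j"
    show "wpt 6 update_body (\<lambda>s. if nmem s ''i'' 0 = j \<and> I (Suc j) (set_nmem ''i'' 0 (Suc j) s)
        then v else \<top>) s \<le> v"
    proof (rule wpt_wpI)
      let ?F = "\<lambda>s. if nmem s ''i'' 0 = j \<and> I (Suc j) (set_nmem ''i'' 0 (Suc j) s) then v else \<top>"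
      have s: "base s" "nmem s ''m'' 0 = m" "nmem s ''c'' 0 = a" "rmem s ''w'' j = w j"
        "rmem s ''out'' 0 = (\<Sum>i<j. upd m w a i)"
        using j by (simp_all add: I_def)
      let ?s = "(set_rmem ''q'' 0 (d j a) s)\<lparr>queries := (j, a) # queries s\<rparr>"
      let ?out = "\<lambda>s'. set_rmem ''out'' 0 ((\<Sum>i<j. upd m w a i) + upd m w a j) s'"
      have eq: "wp update_body F s = F (?out (if 0 < m \<and> w j \<le> d j a then ?s else set_rmem ''w'' j (d j a) ?s))"
        for F
        using s j(1,3) an
        by (cases "m = 0"; cases "d j a < w j") (simp_all add: update_body_def answer_def upd_def min_def)
      have "I (Suc j) (set_nmem ''i'' 0 (Suc j)
        (?out (if 0 < m \<and> w j \<le> d j a then ?s else set_rmem ''w'' j (d j a) ?s)))"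
        using j(2) an by (auto simp: I_def base_def upd_def min_def less_Suc_eq)
      then show "wp update_body ?F s \<le> v" using j(3) by (simp add: eq)
    qed (simp add: update_body_def)
  qed auto
  then show ?thesis
    by (rule order_trans[rotated]) (auto intro!: wpt_mono simp: I_def)
qed

text \<open>Sampling proportional to \<open>w\<close> turns \<open>f\<close> into its weighted
  average. With zero total weight every coin has ratio \<open>0 / 0 = 0\<close> and the candidate is
  whatever it was before, so \<open>v\<close> has to bound all values of \<open>f\<close>.\<close>

lemma sample_loop:
  assumes s: "base s" "nmem s ''m'' 0 = m" "\<forall>i<n. rmem s ''w'' i = w i"
    "rmem s ''R'' 0 = 0" "\<forall>i<n. qcount s i \<le> m"
    and w: "\<And>i. i < n \<Longrightarrow> 0 \<le> w i" and f: "\<And>i. i < n \<Longrightarrow> 0 \<le> f i"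
    and le: "if (\<Sum>i<n. w i) = 0 then \<forall>c<n. f c \<le> v else (\<Sum>a<n. w a / (\<Sum>i<n. w i) * f a) \<le> v"
  shows "wpt (n * 10 + 4) (For ''i'' (nvar ''n'') sample_body)
    (\<lambda>s. if base s \<and> nmem s ''m'' 0 = m \<and> (\<forall>i<n. rmem s ''w'' i = w i) \<and> (\<forall>i<n. qcount s i \<le> m)
      then ennreal (f (nmem s ''c'' 0)) else \<top>) s \<le> ennreal v"
proof -
  define W where "W j = (\<Sum>i<j. w i)" for j
  \<comment> \<open>\<open>\<Psi> j c\<close> is the conditional expectation of \<open>f\<close> at the final sample, given candidate \<open>c\<close> after \<open>j\<close> agents.\<close>
  define \<Psi> where "\<Psi> j c = (if W n = 0 then f c else (W j * f c + (\<Sum>a=j..<n. w a * f a)) / W n)" for j c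
  define I where "I j s \<longleftrightarrow> base s \<and> nmem s ''m'' 0 = m \<and>
    (\<forall>i<n. rmem s ''w'' i = w i) \<and> rmem s ''R'' 0 = W j \<and> (\<forall>i<n. qcount s i \<le> m)" for j s
  have W_mono: "W i \<le> W j" if "i \<le> j" "j \<le> n" for i j
    unfolding W_def using that w by (intro sum_mono2) auto
  have W0: "0 \<le> W j" if "j \<le> n" for j unfolding W_def using that w by (intro sum_nonneg) auto
  have \<Psi>0: "0 \<le> \<Psi> j c" if "j \<le> n" "c < n" for j c
    unfolding \<Psi>_def using f w W0 that by (auto intro!: divide_nonneg_nonneg add_nonneg_nonneg sum_nonneg mult_nonneg_nonneg)
  \<comment> \<open>\<open>\<Psi>\<close> is a martingale. Candidate \<open>j\<close> enters with
    weight \<open>w j\<close>, the old one keeps \<open>W j\<close>, and the agents still to come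
    are unaffected by the toss.\<close>
  have \<Psi>_step: "w j / W (Suc j) * \<Psi> (Suc j) j + (1 - w j / W (Suc j)) * \<Psi> (Suc j) c = \<Psi> j c"
    if "j < n" for j c
  proof (cases "W (Suc j) = 0")
    case True
    have "w j = 0" "W j = 0" using True w[OF that] W0[of j] that by (auto simp: W_def)
    then show ?thesis using that by (simp add: \<Psi>_def sum.atLeast_Suc_lessThan True)
  next
    case False
    then have "W n \<noteq> 0" using W_mono[of "Suc j" n] W0[of "Suc j"] that by simp
    moreover have "1 - w j / W (Suc j) = W j / W (Suc j)"
      using False by (simp add: field_simps W_def)
    moreover have "b / y * ((y * p + t) / x) + a / y * ((y * q + t) / x) = (a * q + (b * p + t)) / x"
      if "a + b = y" "y \<noteq> 0" for a b p q t x y :: real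
    proof -
      have "b / y * ((y * p + t) / x) + a / y * ((y * q + t) / x)
          = (b * p + a * q + (a + b) * t / y) / x"
        using that(2) by (simp add: add_divide_distrib distrib_left distrib_right)
      then show ?thesis using that by simp
    qed
    ultimately show ?thesis using False that
      by (simp add: \<Psi>_def sum.atLeast_Suc_lessThan W_def)
  qed
  have "wpt (n * (6 + 4) + 4) (For ''i'' (nvar ''n'') sample_body)
    (\<lambda>s. if I n s \<and> nmem s ''i'' 0 = n then ennreal (f (nmem s ''c'' 0)) else \<top>) s \<le> ennreal v"
  proof (rule wpt_For[where I = I and g = "\<lambda>j s. ennreal (\<Psi> j (nmem s ''c'' 0))"])
    show "nval (nvar ''n'') s = n" if "I j s" for j s using that by (simp add: I_def base_def)
    show "I 0 (set_nmem ''i'' 0 0 s)" using s by (simp add: I_def base_def W_def)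
    \<comment> \<open>Since \<open>W 0 = 0\<close>, the initial candidate has no influence when the
      total weight is positive.\<close>
    have "\<Psi> 0 (nmem s ''c'' 0) \<le> v"
      using le s(1) by (auto simp: \<Psi>_def W_def base_def atLeast0LessThan sum_divide_distrib split: if_splits)
    then show "ennreal (\<Psi> 0 (nmem (set_nmem ''i'' 0 0 s) ''c'' 0)) \<le> ennreal v"
      by (simp add: ennreal_leI)
    show "ennreal (f (nmem s ''c'' 0)) \<le> ennreal (\<Psi> n (nmem s ''c'' 0))" for s
      by (simp add: \<Psi>_def)
    fix j s assume j: "j < n" "I j s" "nmem s ''i'' 0 = j"
    let ?F = "\<lambda>s. if nmem s ''i'' 0 = j \<and> I (Suc j) (set_nmem ''i'' 0 (Suc j) s)
        then ennreal (\<Psi> (Suc j) (nmem (set_nmem ''i'' 0 (Suc j) s) ''c'' 0)) else \<top>"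
    have R: "W j + w j = W (Suc j)" by (simp add: W_def)
    \<comment> \<open>This also holds when the denominator is 0, so the coin is never
      clipped.\<close>
    have p: "0 \<le> w j / W (Suc j)" "w j / W (Suc j) \<le> 1"
      using w[of j] W0[of j] W0[of "Suc j"] j by (auto simp: R[symmetric] divide_le_eq_1)
    have cn: "nmem s ''c'' 0 < n" using j by (auto simp: I_def base_def)
    show "wpt 6 sample_body ?F s \<le> ennreal (\<Psi> j (nmem s ''c'' 0))"
    proof (rule wpt_wpI)
      have "wp sample_body ?F s = ennreal (w j / W (Suc j)) * ennreal (\<Psi> (Suc j) j)
        + ennreal (1 - w j / W (Suc j)) * ennreal (\<Psi> (Suc j) (nmem s ''c'' 0))"
        using j p R by (simp add: sample_body_def I_def base_def Let_def)
      also have "\<dots> = ennreal (\<Psi> j (nmem s ''c'' 0))"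
        unfolding \<Psi>_step[OF j(1), symmetric] using p \<Psi>0 j cn by (intro ennreal_convex_combination) auto
      finally show "wp sample_body ?F s \<le> ennreal (\<Psi> j (nmem s ''c'' 0))" by simp
    qed (simp add: sample_body_def)
  qed
  then show ?thesis
    by (rule order_trans[rotated]) (auto intro!: wpt_mono simp: I_def)
qed

lemma weights_set_dist:
  assumes "S \<in> solutions n m" "\<And>i. i < n \<Longrightarrow> w i = set_dist d i S"
  shows "weights w"
  unfolding weights_def
proof (intro conjI allI impI)
  fix i j assume ij: "i < n" "j < n"
  note SD = solutionsD[OF assms(1)]
  obtain c where c: "c \<in> S" "set_dist d j S = d j c" using set_dist_attained[OF SD(1,2)] by metis
  have "set_dist d i S \<le> d i c" using c SD by (intro set_dist_le) auto
  also have "\<dots> \<le> d i j + d j c" using dist_tri ij c SD(3) by auto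
  finally show "w i \<le> w j + d i j" using ij assms(2) c by simp
qed (use assms set_dist_nonneg in auto)

text \<open>One round unfolds one level of \<open>dsample_cost\<close>: the sampling loop averages
  over the new center, and the update loop replaces the weights by their minima with its
  distances.\<close>

lemma sampling_round:
  assumes m: "m < k" and s: "Inv m s" "nmem s ''m'' 0 = m"
  shows "wpt (n * 20 + 13) sampling_round
    (\<lambda>s. if nmem s ''m'' 0 = m \<and> Inv (Suc m) s then ennreal (val (Suc m) (rmem s ''w'')) else \<top>) s
    \<le> ennreal (val m (rmem s ''w''))" (is "wpt _ _ ?F s \<le> _")
proof -
  define w where "w = rmem s ''w''"
  define f where "f a = val (Suc m) (upd m w a)" for a
  have upd: "weights (upd m w a)" if "a < n" for a
  proof (cases "m = 0")
    case True
    then have "upd m w a = (\<lambda>i. d i a)" by (simp add: upd_def fun_eq_iff)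
    then show ?thesis using weights_dist[OF that] by simp
  next
    case False
    then have "weights w" using s(1) weights_set_dist unfolding Inv_def w_def by blast
    moreover have "upd m w a = (\<lambda>i. min (w i) (d i a))" using False by (simp add: upd_def fun_eq_iff)
    ultimately show ?thesis using weights_min that by simp
  qed
  have f0: "0 \<le> f a" if "a < n" for a
    unfolding f_def val_def using dsample_cost_nonneg[OF upd[OF that]] by simp
  have w0: "0 \<le> w i" if "i < n" for i
  proof (cases "m = 0")
    case False
    then have "weights w" using s(1) weights_set_dist unfolding Inv_def w_def by blast
    then show ?thesis using that by (simp add: weights_def)
  qed (use s(1) that in \<open>simp add: Inv_def w_def\<close>)
  have le: "if (\<Sum>i<n. w i) = 0 then \<forall>c<n. f c \<le> val m w else (\<Sum>a<n. w a / (\<Sum>i<n. w i) * f a) \<le> val m w"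
  proof (cases "m = 0")
    case True
    then have w1: "w i = 1" if "i < n" for i using s(1) that by (simp add: Inv_def w_def)
    have "f a = dsample_cost (k - 1) (\<lambda>i. d i a)" for a
      using True by (simp add: f_def val_def upd_def[abs_def])
    then show ?thesis using True w1 k by (simp add: val_def sum_divide_distrib)
  next
    case False
    have f: "f a = dsample_cost (k - Suc m) (\<lambda>i. min (w i) (d i a))" for a
      using False by (simp add: f_def val_def upd_def[abs_def])
    have km: "k - m = Suc (k - Suc m)" using m by simp
    show ?thesis
    proof (cases "(\<Sum>i<n. w i) = 0")
      \<comment> \<open>All weights are 0 and remain 0, so the cost is 0 whichever candidate was
        left over.\<close>
      case True
      then have "w i = 0" if "i < n" for i using w0 that sum_nonneg_eq_0_iff[of "{..<n}" w] by auto
      then have "f c = 0" if "c < n" for c unfolding f using dist_nonneg that by (intro dsample_cost_zero) simp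
      then show ?thesis using True False by (simp add: val_def km)
    next
      case nz: False
      then show ?thesis using False by (simp add: val_def km f)
    qed
  qed
  have update: "wpt (n * 10 + 4) (For ''i'' (nvar ''n'') update_body) ?F s' \<le> ennreal (f (nmem s' ''c'' 0))"
    if s': "base s'" "nmem s' ''m'' 0 = m" "\<forall>i<n. rmem s' ''w'' i = w i"
      "rmem s' ''out'' 0 = 0" "\<forall>i<n. qcount s' i \<le> m" for s'
  proof (rule order_trans[OF wpt_mono update_loop[OF s'(1,2) refl s'(3-5)]])
    fix s''
    let ?a = "nmem s' ''c'' 0"
    have a: "?a < n" using s' by (simp add: base_def)
    let ?Q = "base s'' \<and> nmem s'' ''m'' 0 = m \<and> (\<forall>i<n. rmem s'' ''w'' i = upd m w ?a i) \<and>
        rmem s'' ''out'' 0 = (\<Sum>i<n. upd m w ?a i) \<and> (\<forall>i<n. qcount s'' i \<le> Suc m)"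
    show "?F s'' \<le> (if ?Q then ennreal (f ?a) else \<top>)"
    proof (cases ?Q)
      case True
      have "\<exists>S\<in>solutions n (Suc m). \<forall>i<n. upd m w ?a i = set_dist d i S"
      proof (cases "m = 0")
        case True
        then show ?thesis using a by (intro bexI[of _ "{?a}"]) (auto simp: upd_def solutions_def)
      next
        case False
        then obtain S where S: "S \<in> solutions n m" "\<forall>i<n. w i = set_dist d i S"
          using s(1) by (auto simp: Inv_def w_def)
        note SD = solutionsD[OF S(1)]
        have "insert ?a S \<in> solutions n (Suc m)"
          using S(1) SD(1) a by (auto simp: solutions_def card_insert_if)
        then show ?thesis using False S(2) SD(1,2)
          by (intro bexI[of _ "insert ?a S"]) (auto simp: upd_def set_dist_insert min.commute)
      qed
      moreover have "val (Suc m) (rmem s'' ''w'') = f ?a"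
        unfolding f_def using True by (intro val_cong) simp
      ultimately show ?thesis using True by (auto simp: Inv_def)
    next
      case False
      then show ?thesis by auto
    qed
  qed
  have "wpt (Suc (1 + Suc (n * 10 + 4 + Suc (1 + (n * 10 + 4))))) sampling_round ?F s \<le> ennreal (val m w)"
    unfolding sampling_round_def
  proof (rule wpt_SeqI)
    let ?Q = "\<lambda>s. base s \<and> nmem s ''m'' 0 = m \<and> (\<forall>i<n. rmem s ''w'' i = w i) \<and> (\<forall>i<n. qcount s i \<le> m)"
    let ?G = "\<lambda>s. if ?Q s then ennreal (f (nmem s ''c'' 0)) else \<top>"
    let ?R = "RAssign ''R'' (NConst 0) (RNat (NConst 0))"
    show "wpt 1 ?R (\<lambda>s. if ?Q s \<and> rmem s ''R'' 0 = 0 then ennreal (val m w) else \<top>) s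
      \<le> ennreal (val m w)"
      by (rule wpt_wpI) (use s in \<open>auto simp: Inv_def base_def w_def\<close>)
    show "wpt (Suc (n * 10 + 4 + Suc (1 + (n * 10 + 4))))
      (Seq (For ''i'' (nvar ''n'') sample_body)
        (Seq (RAssign ''out'' (NConst 0) (RNat (NConst 0))) (For ''i'' (nvar ''n'') update_body))) ?F s'
      \<le> (if ?Q s' \<and> rmem s' ''R'' 0 = 0 then ennreal (val m w) else \<top>)" for s'
    proof (cases "?Q s' \<and> rmem s' ''R'' 0 = 0")
      case True
      have "wpt (Suc (n * 10 + 4 + Suc (1 + (n * 10 + 4))))
        (Seq (For ''i'' (nvar ''n'') sample_body)
          (Seq (RAssign ''out'' (NConst 0) (RNat (NConst 0))) (For ''i'' (nvar ''n'') update_body))) ?F s'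
        \<le> ennreal (val m w)"
      proof (rule wpt_SeqI[where g = ?G])
        show "wpt (n * 10 + 4) (For ''i'' (nvar ''n'') sample_body) ?G s' \<le> ennreal (val m w)"
          using True w0 f0 le by (intro sample_loop) auto
        show "wpt (Suc (1 + (n * 10 + 4)))
          (Seq (RAssign ''out'' (NConst 0) (RNat (NConst 0))) (For ''i'' (nvar ''n'') update_body)) ?F s''
          \<le> ?G s''" for s''
        proof (rule wpt_SeqI[OF wpt_wpI order_refl])
          show "wp (RAssign ''out'' (NConst 0) (RNat (NConst 0)))
            (wpt (n * 10 + 4) (For ''i'' (nvar ''n'') update_body) ?F) s'' \<le> ?G s''"
            using update[of "set_rmem ''out'' 0 0 s''"] by (auto simp: base_def)
        qed simp
      qed
      then show ?thesis using True by simp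
    next
      case False
      then show ?thesis by auto
    qed
  qed
  moreover have "Suc (1 + Suc (n * 10 + 4 + Suc (1 + (n * 10 + 4)))) \<le> n * 20 + 13" by simp
  ultimately show ?thesis unfolding w_def using wpt_time_mono order_trans by blast
qed

text \<open>Chains the rounds through \<open>val\<close>, which starts at the stated average
  whatever the weights are and ends at the sum stored in \<open>out\<close>.\<close>

lemma sampling_wpt:
  "wpt (9 + 22 * n + 20 * n ^ 2) sampling
    (\<lambda>s. if Inv k s then ennreal (rmem s ''out'' 0) else \<top>) (init_state n k l)
    \<le> ennreal ((\<Sum>a<n. dsample_cost (k - 1) (\<lambda>i. d i a)) / real n)" (is "wpt _ _ ?f ?s \<le> ennreal ?v")
proof -
  define I where "I j s \<longleftrightarrow> base s \<and> (\<forall>i<j. rmem s ''w'' i = 1) \<and> (\<forall>i. qcount s i = 0)" for j s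
  have v: "val 0 w = ?v" for w by (simp add: val_def)
  have "wpt (Suc ((n * (1 + 4) + 4) + (k * (n * 20 + 13 + 4) + 4))) sampling ?f ?s \<le> ennreal ?v"
    unfolding sampling_def
  proof (rule wpt_SeqI)
    show "wpt (n * (1 + 4) + 4) (For ''i'' (nvar ''n'') (RAssign ''w'' (nvar ''i'') (RNat (NConst 1))))
      (\<lambda>s. if I n s \<and> nmem s ''i'' 0 = n then ennreal ?v else \<top>) ?s \<le> ennreal ?v"
    proof (rule wpt_For[where I = I and g = "\<lambda>_ _. ennreal ?v"])
      show "nval (nvar ''n'') s = n" if "I j s" for j s using that by (simp add: I_def base_def)
      show "I 0 (set_nmem ''i'' 0 0 ?s)" using k by (simp add: I_def base_def init_state_def qcount_def)
      fix j s assume "j < n" "I j s" "nmem s ''i'' 0 = j"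
      then show "wpt 1 (RAssign ''w'' (nvar ''i'') (RNat (NConst 1)))
        (\<lambda>s. if nmem s ''i'' 0 = j \<and> I (Suc j) (set_nmem ''i'' 0 (Suc j) s) then ennreal ?v else \<top>) s
        \<le> ennreal ?v"
        by (intro wpt_wpI) (auto simp: I_def base_def less_Suc_eq)
    qed auto
    show "wpt (k * (n * 20 + 13 + 4) + 4) (For ''m'' (nvar ''k'') sampling_round) ?f s
      \<le> (if I n s \<and> nmem s ''i'' 0 = n then ennreal ?v else \<top>)" for s
    proof (cases "I n s \<and> nmem s ''i'' 0 = n")
      case True
      have Inv_set: "Inv j (set_nmem ''m'' 0 j' s) = Inv j s" for j j' s
        by (simp add: Inv_def base_def)
      have "wpt (k * (n * 20 + 13 + 4) + 4) (For ''m'' (nvar ''k'') sampling_round)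
        (\<lambda>s. if Inv k s \<and> nmem s ''m'' 0 = k then ennreal (rmem s ''out'' 0) else \<top>) s \<le> ennreal ?v"
      proof (rule wpt_For[where I = Inv and g = "\<lambda>m s. ennreal (val m (rmem s ''w''))"])
        show "nval (nvar ''k'') s = k" if "Inv j s" for j s using that by (simp add: Inv_def base_def)
        show "Inv 0 (set_nmem ''m'' 0 0 s)" using True by (simp add: Inv_def I_def base_def)
        show "ennreal (rmem s ''out'' 0) \<le> ennreal (val k (rmem s ''w''))" if "Inv k s" for s
          using that k by (simp add: Inv_def val_def)
        fix m s assume "m < k" "Inv m s" "nmem s ''m'' 0 = m"
        from sampling_round[OF this]
        show "wpt (n * 20 + 13) sampling_round
          (\<lambda>s. if nmem s ''m'' 0 = m \<and> Inv (Suc m) (set_nmem ''m'' 0 (Suc m) s)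
            then ennreal (val (Suc m) (rmem (set_nmem ''m'' 0 (Suc m) s) ''w'')) else \<top>) s
          \<le> ennreal (val m (rmem s ''w''))"
          unfolding Inv_set rmem_set_nmem .
      qed (simp add: v)
      then show ?thesis using True
        by (simp, elim order_trans[rotated]) (auto intro!: wpt_mono)
    next
      case False
      then show ?thesis by auto
    qed
  qed
  moreover have "Suc ((n * (1 + 4) + 4) + (k * (n * 20 + 13 + 4) + 4)) \<le> 9 + 22 * n + 20 * n ^ 2"
    using mult_le_mono1[OF k(2), of "n * 20 + 17"] by (simp add: power2_eq_square algebra_simps)
  ultimately show ?thesis using wpt_time_mono order_trans by blast
qed

lemma sampling_correct:
  assumes l: "1 \<le> l" "l \<le> n"
  defines "p \<equiv> steps n \<sigma> d (9 + 22 * n + 20 * n ^ 2) (sampling, init_state n k l)"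
  shows "\<forall>cs\<in>set_pmf p. fst cs = SKIP \<and> (\<forall>i<n. qcount (snd cs) i \<le> k)"
    and "1 / 2 \<le> measure_pmf.prob p {cs. OPT {..<n} d k l \<le> rmem (snd cs) ''out'' 0 \<and>
      rmem (snd cs) ''out'' 0 \<le> 8 * (ln (real k) + 2) * (real n / real l) * OPT {..<n} d k l}"
proof -
  let ?out = "\<lambda>cs. rmem (snd cs) ''out'' 0"
  let ?O = "OPT {..<n} d k l"
  define \<mu> where "\<mu> = 4 * (ln (real k) + 2) * (real n / real l) * ?O"
  let ?f = "\<lambda>s. if Inv k s then ennreal (rmem s ''out'' 0) else \<top>"
  let ?h = "\<lambda>cs. if fst cs = SKIP then ?f (snd cs) else \<top>"
  \<comment> \<open>\<open>S\<close> is chosen optimal for the given \<open>l\<close>. The sampling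
    bound holds against any solution, so it applies to \<open>S\<close> without passing through an
    optimum for the sum.\<close>
  obtain S where S: "S \<in> solutions n k" "?O = Top l {..<n} (\<lambda>i. set_dist d i S)"
    using OPT_attained k by metis
  have "real l * (\<Sum>i<n. set_dist d i S) \<le> real n * ?O"
    using sum_le_Top[of "{..<n}" l "\<lambda>i. set_dist d i S"] l S(2) by simp
  then have sumS: "(\<Sum>i<n. set_dist d i S) \<le> real n / real l * ?O"
    using l by (simp add: field_simps)
  have sumS0: "0 \<le> (\<Sum>i<n. set_dist d i S)" using set_dist_nonneg[OF S(1)] by (intro sum_nonneg) auto
  have lnk: "0 \<le> 4 * (ln (real k) + 2)" using k by simp
  have \<mu>: "(\<Sum>a<n. dsample_cost (k - 1) (\<lambda>i. d i a)) / real n \<le> \<mu>"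
    using order_trans[OF dsample_cost_expected[OF k S(1)] mult_left_mono[OF sumS lnk]]
    by (simp add: \<mu>_def mult.assoc)
  have \<mu>0: "0 \<le> \<mu>" using mult_nonneg_nonneg[OF lnk order_trans[OF sumS0 sumS]] by (simp add: \<mu>_def mult.assoc)
  have int: "(\<integral>\<^sup>+ cs. ?h cs \<partial>measure_pmf p) \<le> ennreal \<mu>"
    using order_trans[OF sampling_wpt ennreal_leI[OF \<mu>]] unfolding wpt_def p_def .
  have fin: "wpt (9 + 22 * n + 20 * n ^ 2) sampling ?f (init_state n k l) < \<top>"
    using int unfolding wpt_def p_def using ennreal_less_top order_le_less_trans by blast
  have halt: "fst cs = SKIP \<and> Inv k (snd cs)" if "cs \<in> set_pmf p" for cs
    using wpt_finiteD[OF fin that[unfolded p_def]] by (auto split: if_splits)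
  then show "\<forall>cs\<in>set_pmf p. fst cs = SKIP \<and> (\<forall>i<n. qcount (snd cs) i \<le> k)"
    by (auto simp: Inv_def)
  \<comment> \<open>Holds in every outcome: \<open>out\<close> is the sum of distances to an actual
    solution.\<close>
  have lower: "?O \<le> ?out cs" if cs: "cs \<in> set_pmf p" for cs
  proof -
    from halt[OF cs] obtain S' where S': "S' \<in> solutions n k"
      "\<forall>i<n. rmem (snd cs) ''w'' i = set_dist d i S'" "?out cs = (\<Sum>i<n. rmem (snd cs) ''w'' i)"
      using k by (auto simp: Inv_def)
    have "?O \<le> Top l {..<n} (\<lambda>i. set_dist d i S')" by (rule OPT_le[OF S'(1)])
    also have "\<dots> \<le> (\<Sum>i<n. set_dist d i S')"
      using set_dist_nonneg[OF S'(1)] by (intro Top_le_sum) auto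
    finally show ?thesis using S' by simp
  qed
  have upper: "?out cs \<le> 2 * \<mu>" if "cs \<in> set_pmf p" "?h cs \<le> ennreal (2 * \<mu>)" for cs
    using that halt[OF that(1)] \<mu>0 by (simp add: ennreal_le_iff)
  have "1 / 2 \<le> measure_pmf.prob p {cs. ?h cs \<le> ennreal (2 * \<mu>)}"
    by (rule pmf_Markov_half[OF int \<mu>0])
  also have "\<dots> \<le> measure_pmf.prob p {cs. ?O \<le> ?out cs \<and> ?out cs \<le> 2 * \<mu>}"
    using lower upper by (intro measure_pmf.finite_measure_mono_AE) (auto simp: AE_measure_pmf_iff)
  also have "2 * \<mu> = 8 * (ln (real k) + 2) * (real n / real l) * ?O" by (simp add: \<mu>_def)
  finally show "1 / 2 \<le> measure_pmf.prob p {cs. ?O \<le> ?out cs \<and>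
      ?out cs \<le> 8 * (ln (real k) + 2) * (real n / real l) * ?O}" .
qed

end

theorem theorem1p2:
  shows
    "(\<exists>(mech :: com) (T :: nat poly) (A :: nat).
        coin_free mech \<and>
        (\<forall>(n :: nat) (k :: nat) (l :: nat) (\<sigma> :: nat \<Rightarrow> nat rel) (d :: nat \<Rightarrow> nat \<Rightarrow> real).
           k \<in> {1..n} \<longrightarrow> l \<in> {1..n} \<longrightarrow>
           pseudometric_on {..<n} d \<longrightarrow> consistent_profile {..<n} \<sigma> d \<longrightarrow>
           (\<forall>cs \<in> set_pmf (run mech n k l \<sigma> d (poly T n)).
              halted cs \<and>
              OPT {..<n} d k l \<le> estimate cs \<and>
              estimate cs \<le> 2 * real l * OPT {..<n} d k l \<and>
              (\<forall>i<n. agent_queries cs i \<le> A * k) \<and>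
              total_queries n cs \<le> A * k ^ 2)))
     \<and>
     (\<exists>(mech :: com) (T :: nat poly) (A :: nat).
        \<forall>(n :: nat) (k :: nat) (l :: nat) (\<sigma> :: nat \<Rightarrow> nat rel) (d :: nat \<Rightarrow> nat \<Rightarrow> real).
           k \<in> {1..n} \<longrightarrow> l \<in> {1..n} \<longrightarrow>
           pseudometric_on {..<n} d \<longrightarrow> consistent_profile {..<n} \<sigma> d \<longrightarrow>
           (\<forall>cs \<in> set_pmf (run mech n k l \<sigma> d (poly T n)).
              halted cs \<and> (\<forall>i<n. agent_queries cs i \<le> A * k)) \<and>
           measure_pmf.prob (run mech n k l \<sigma> d (poly T n))
             {cs. OPT {..<n} d k l \<le> estimate cs \<and>
                  estimate cs \<le> 8 * (ln (real k) + 2) * (real n / real l) * OPT {..<n} d k l}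
             \<ge> 1 / 2)"
  proof (intro conjI)
  let ?T = "[:9, 25, 26:] :: nat poly"
  have T: "poly ?T n = 9 + 25 * n + 26 * n\<^sup>2" for n
    by (simp add: power2_eq_square algebra_simps)
  have "halted cs \<and> OPT {..<n} d k l \<le> estimate cs \<and>
      estimate cs \<le> 2 * real l * OPT {..<n} d k l \<and>
      (\<forall>i<n. agent_queries cs i \<le> 1 * k) \<and> total_queries n cs \<le> 1 * k ^ 2"
    if "k \<in> {1..n}" "l \<in> {1..n}" "pseudometric_on {..<n} d" "consistent_profile {..<n} \<sigma> d"
      and cs: "cs \<in> set_pmf (run farthest_first n k l \<sigma> d (poly ?T n))"
    for n k l \<sigma> d cs
  proof -
    interpret farthest_run n \<sigma> d k l
      using that by unfold_locales auto
    have c: "fst cs = SKIP" "good (snd cs)" "rmem (snd cs) ''out'' 0 = real l * rmem (snd cs) ''r'' 0"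
      using farthest_first_correct[of cs] cs unfolding run_def T by auto
    then have "real l * rmem (snd cs) ''r'' 0 \<le> real l * (2 * OPT {..<n} d k l)"
      by (intro mult_left_mono) (auto simp: good_def)
    with c show ?thesis
      by (simp add: halted_def estimate_def agent_queries_def total_queries_def good_def
        qcount_def[symmetric] mult_ac)
  qed
  then show "\<exists>(mech :: com) (T :: nat poly) (A :: nat).
        coin_free mech \<and>
        (\<forall>(n :: nat) (k :: nat) (l :: nat) (\<sigma> :: nat \<Rightarrow> nat rel) (d :: nat \<Rightarrow> nat \<Rightarrow> real).
           k \<in> {1..n} \<longrightarrow> l \<in> {1..n} \<longrightarrow>
           pseudometric_on {..<n} d \<longrightarrow> consistent_profile {..<n} \<sigma> d \<longrightarrow>
           (\<forall>cs \<in> set_pmf (run mech n k l \<sigma> d (poly T n)).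
              halted cs \<and>
              OPT {..<n} d k l \<le> estimate cs \<and>
              estimate cs \<le> 2 * real l * OPT {..<n} d k l \<and>
              (\<forall>i<n. agent_queries cs i \<le> A * k) \<and>
              total_queries n cs \<le> A * k ^ 2))"
    by (intro exI[of _ farthest_first] exI[of _ ?T] exI[of _ 1] conjI coin_free_farthest_first allI impI ballI)
      blast+
next
  let ?T = "[:9, 22, 20:] :: nat poly"
  have T: "poly ?T n = 9 + 22 * n + 20 * n ^ 2" for n
    by (simp add: power2_eq_square algebra_simps)
  have "(\<forall>cs \<in> set_pmf (run sampling n k l \<sigma> d (poly ?T n)).
          halted cs \<and> (\<forall>i<n. agent_queries cs i \<le> 1 * k)) \<and>
        measure_pmf.prob (run sampling n k l \<sigma> d (poly ?T n))
          {cs. OPT {..<n} d k l \<le> estimate cs \<and>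
             estimate cs \<le> 8 * (ln (real k) + 2) * (real n / real l) * OPT {..<n} d k l} \<ge> 1 / 2"
    if "k \<in> {1..n}" "l \<in> {1..n}" "pseudometric_on {..<n} d"
    for n k l \<sigma> d
  proof -
    interpret sampling_run n \<sigma> d k
      using that by unfold_locales auto
    have l: "1 \<le> l" "l \<le> n" using that by auto
    show ?thesis
      using sampling_correct[OF l]
      unfolding run_def T halted_def agent_queries_def qcount_def estimate_def by simp
  qed
  then show "\<exists>(mech :: com) (T :: nat poly) (A :: nat).
        \<forall>(n :: nat) (k :: nat) (l :: nat) (\<sigma> :: nat \<Rightarrow> nat rel) (d :: nat \<Rightarrow> nat \<Rightarrow> real).
           k \<in> {1..n} \<longrightarrow> l \<in> {1..n} \<longrightarrow>
           pseudometric_on {..<n} d \<longrightarrow> consistent_profile {..<n} \<sigma> d \<longrightarrow>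
           (\<forall>cs \<in> set_pmf (run mech n k l \<sigma> d (poly T n)).
              halted cs \<and> (\<forall>i<n. agent_queries cs i \<le> A * k)) \<and>
           measure_pmf.prob (run mech n k l \<sigma> d (poly T n))
             {cs. OPT {..<n} d k l \<le> estimate cs \<and>
                  estimate cs \<le> 8 * (ln (real k) + 2) * (real n / real l) * OPT {..<n} d k l}
             \<ge> 1 / 2"
    by (intro exI[of _ sampling] exI[of _ ?T] exI[of _ 1] allI impI) blast
qed

end
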